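(* Let $\mu$ and $\nu$ be Borel probability measures on $\mathbf{R}$. The following construction (of the excursion coupling of $\mu$ and $\nu$) is well defined and yields an element of $\mathrm{Marg}(\mu,\nu)$. (1) Assume $\mu\perp\nu$ and let $\sigma=\mu-\nu$. Let $\theta$ be the measure on $\mathbf{R}$ with density (with respect to Lebesgue measure) $h\mapsto i^\pm(h)=\mathrm{card}[(\mathbf{R}\times\{h\})\cap\mathrm{Graph}^{*,+}(F_\sigma)]+\mathrm{card}[(\mathbf{R}\times\{h\})\cap\mathrm{Graph}^{*,-}(F_\sigma)]$. Then $\theta/2$ is a probability measure. Let $H$ be a random variable with law $\theta/2$ and $N=i^\pm(H)$. Almost surely, $N$ is finite and even and $(\mathbf{R}\times\{H\})\cap\mathrm{Graph}^*(F_\sigma)=(\mathbf{R}\times\{H\})\cap(\mathrm{Graph}^{*,-}(F_\sigma)\cup\mathrm{Graph}^{*,+}(F_\sigma))$, so that this set can be written $\{x_1,\dots,x_N\}\times\{H\}$ with $x_1<\dots<x_N$. If, conditionally on $H$, the random vector $(X,Y)$ is uniform on $\{(x_1,x_2),(x_3,x_4),\dots,(x_{N-1},x_N)\}$ when $H>0$ and uniform on $\{(x_2,x_1),(x_4,x_3),\dots,(x_N,x_{N-1})\}$ when $H<0$, then $X$ has law $\mu$ and $Y$ has law $\nu$. (2) In general, write $\mu=\eta+\mu_0$ and $\nu=\eta+\nu_0$ with positive measures $\eta,\mu_0,\nu_0$ such that $\mu_0\perp\nu_0$. Let $(X,Y)$ be such that with probability $\eta(\mathbf{R})$ it satisfies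 $X=Y$ with $X$ distributed as (normalized) $\eta$, and on the complementary event, of probability $1-\eta(\mathbf{R})=\mu_0(\mathbf{R})$, it is distributed as the coupling, defined in (1), of the singular probability measures $\mu_0(\mathbf{R})^{-1}\mu_0$ and $\nu_0(\mathbf{R})^{-1}\nu_0$. Then $X$ has law $\mu$ and $Y$ has law $\nu$.
   Context: $\mathrm{Marg}(\mu,\nu)$ is the set of Borel probability measures on $\mathbf{R}\times\mathbf{R}$ with first marginal $\mu$ and second marginal $\nu$. For $\sigma=\mu-\nu$, $F_\sigma(x)=\sigma(]-\infty,x])$, a càdlàg function with left limits denoted $F_\sigma(x^-)$. The multivalued map $F_\sigma^*$ is $F^*_\sigma(x)=[F_\sigma(x^-),F_\sigma(x)]$ (the closed interval between the two values, in whichever order) at discontinuity points of $F_\sigma$ and $F_\sigma^*(x)=\{F_\sigma(x)\}$ at continuity points; $\mathrm{Graph}^*(F_\sigma)=\{(x,h)\in\mathbf{R}^2:h\in F^*_\sigma(x)\}$. $\mathrm{Graph}^{*,+}(F_\sigma)$ (resp. $\mathrm{Graph}^{*,-}(F_\sigma)$) is the set of points $(x,h)\in\mathrm{Graph}^*(F_\sigma)$ for which there is a neighborhood $U_x$ of $x$ such that every $(x',h')\in\mathrm{Graph}^*(F_\sigma)$ with $x'\in U_x\setminus\{x\}$ satisfies $(h'-h)(x'-x)>0$ (resp. $<0$). *)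

theory Defs
  imports "HOL-Probability.Probability"
begin

definition mutually_singular :: "real measure \<Rightarrow> real measure \<Rightarrow> bool" where
  "mutually_singular \<mu> \<nu> \<longleftrightarrow>
     (\<exists>A\<in>sets borel. emeasure \<mu> A = 0 \<and> emeasure \<nu> (UNIV - A) = 0)"

definition Marg :: "real measure \<Rightarrow> real measure \<Rightarrow> (real \<times> real) measure set" where
  "Marg \<mu> \<nu> = {\<pi>. prob_space \<pi> \<and> sets \<pi> = sets borel \<and>
                  distr \<pi> borel fst = \<mu> \<and> distr \<pi> borel snd = \<nu>}"

(* The distribution function of the signed measure \<mu> - \<nu> (for finite \<mu> and \<nu>). *)
definition diff_cdf :: "real measure \<Rightarrow> real measure \<Rightarrow> real \<Rightarrow> real" where
  "diff_cdf \<mu> \<nu> x = cdf \<mu> x - cdf \<nu> x"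

definition F_star :: "(real \<Rightarrow> real) \<Rightarrow> real \<Rightarrow> real set" where
  "F_star F x = (if isCont F x then {F x} else closed_segment (Lim (at_left x) F) (F x))"

definition Graph_star :: "(real \<Rightarrow> real) \<Rightarrow> (real \<times> real) set" where
  "Graph_star F = {(x, h). h \<in> F_star F x}"

definition Graph_star_plus :: "(real \<Rightarrow> real) \<Rightarrow> (real \<times> real) set" where
  "Graph_star_plus F = {(x, h). (x, h) \<in> Graph_star F \<and>
     (\<exists>U. open U \<and> x \<in> U \<and>
       (\<forall>(x', h')\<in>Graph_star F. x' \<in> U - {x} \<longrightarrow> (h' - h) * (x' - x) > 0))}"

definition Graph_star_minus :: "(real \<Rightarrow> real) \<Rightarrow> (real \<times> real) set" where
  "Graph_star_minus F = {(x, h). (x, h) \<in> Graph_star F \<and>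
     (\<exists>U. open U \<and> x \<in> U \<and>
       (\<forall>(x', h')\<in>Graph_star F. x' \<in> U - {x} \<longrightarrow> (h' - h) * (x' - x) < 0))}"

(* Cardinalities are taken in [0, \<infinity>] by means of the counting measure, since
   card would send infinite sets to 0. *)
definition crossing_number :: "(real \<Rightarrow> real) \<Rightarrow> real \<Rightarrow> ennreal" where
  "crossing_number F h =
     emeasure (count_space UNIV) ((UNIV \<times> {h}) \<inter> Graph_star_plus F) +
     emeasure (count_space UNIV) ((UNIV \<times> {h}) \<inter> Graph_star_minus F)"

(* The measure \<theta>/2. Note that density is only meaningful for measurable densities. *)
definition level_law :: "real measure \<Rightarrow> real measure \<Rightarrow> real measure" where
  "level_law \<mu> \<nu> = scale_measure (1/2) (density lborel (crossing_number (diff_cdf \<mu> \<nu>)))"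

(* The list x_1 < ... < x_N is indexed from 0 here, and it is empty if the level set is infinite. *)
definition excursion_pairs :: "(real \<Rightarrow> real) \<Rightarrow> real \<Rightarrow> (real \<times> real) set" where
  "excursion_pairs F h =
     (let xs = sorted_list_of_set {x. (x, h) \<in> Graph_star F} in
      if h > 0 then {(xs ! (2 * i), xs ! (2 * i + 1)) |i. 2 * i + 1 < length xs}
      else if h < 0 then {(xs ! (2 * i + 1), xs ! (2 * i)) |i. 2 * i + 1 < length xs}
      else {})"

(* Uniform law on the excursion pairs at level h. The point mass at the origin is a
   placeholder at levels without any pairs. *)
definition excursion_kernel :: "(real \<Rightarrow> real) \<Rightarrow> real \<Rightarrow> (real \<times> real) measure" where
  "excursion_kernel F h =
     (if excursion_pairs F h = {} then return borel (0, 0)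
      else distr (measure_pmf (pmf_of_set (excursion_pairs F h))) borel (\<lambda>p. p))"

(* \<kappa> is a version of the conditional law of Z given H. *)
definition conditional_law ::
  "'a measure \<Rightarrow> ('a \<Rightarrow> real) \<Rightarrow> ('a \<Rightarrow> real \<times> real) \<Rightarrow> (real \<Rightarrow> (real \<times> real) measure) \<Rightarrow> bool" where
  "conditional_law M H Z \<kappa> \<longleftrightarrow>
     (\<forall>B\<in>sets borel. \<forall>C\<in>sets borel.
        emeasure M {\<omega> \<in> space M. H \<omega> \<in> B \<and> Z \<omega> \<in> C} =
        (\<integral>\<^sup>+h\<in>B. emeasure (\<kappa> h) C \<partial>distr M borel H))"

definition singular_excursion_coupling ::
  "real measure \<Rightarrow> real measure \<Rightarrow> (real \<times> real) measure" where
  "singular_excursion_coupling \<mu> \<nu> = level_law \<mu> \<nu> \<bind> excursion_kernel (diff_cdf \<mu> \<nu>)"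

definition common_part_decomposition ::
  "real measure \<Rightarrow> real measure \<Rightarrow> real measure \<Rightarrow> real measure \<Rightarrow> real measure \<Rightarrow> bool" where
  "common_part_decomposition \<mu> \<nu> \<eta> \<mu>\<^sub>0 \<nu>\<^sub>0 \<longleftrightarrow>
     sets \<eta> = sets borel \<and> sets \<mu>\<^sub>0 = sets borel \<and> sets \<nu>\<^sub>0 = sets borel \<and>
     (\<forall>A\<in>sets borel. emeasure \<mu> A = emeasure \<eta> A + emeasure \<mu>\<^sub>0 A) \<and>
     (\<forall>A\<in>sets borel. emeasure \<nu> A = emeasure \<eta> A + emeasure \<nu>\<^sub>0 A) \<and>
     mutually_singular \<mu>\<^sub>0 \<nu>\<^sub>0"

definition normalized :: "real measure \<Rightarrow> real measure" where
  "normalized \<mu> = scale_measure (inverse (emeasure \<mu> UNIV)) \<mu>"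

(* The mixture of the laws of the two cases. The weight \<eta>(UNIV) cancels the normalization
   of \<eta>, and the second summand vanishes if \<mu>\<^sub>0 = 0. *)
definition excursion_coupling ::
  "real measure \<Rightarrow> real measure \<Rightarrow> real measure \<Rightarrow> (real \<times> real) measure" where
  "excursion_coupling \<eta> \<mu>\<^sub>0 \<nu>\<^sub>0 = measure_of UNIV (sets borel)
     (\<lambda>C. emeasure (distr \<eta> borel (\<lambda>x. (x, x))) C +
          emeasure \<mu>\<^sub>0 UNIV *
            emeasure (singular_excursion_coupling (normalized \<mu>\<^sub>0) (normalized \<nu>\<^sub>0)) C)"

end

theory Submission
  imports Defs
begin

text \<open>
  Write \<open>F\<close> for the distribution function of \<open>\<mu> - \<nu>\<close>, and call \<open>{x. (x, h) \<in> Graph_star F}\<close> the level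
  of \<open>F\<close> at height \<open>h\<close>. The proof uses neither derivatives nor an area formula: everything follows
  from counting the points of the levels and from the minimality of the Jordan decomposition.

  \<^bold>\<open>Almost every level is finite.\<close> The heights whose level meets a cell \<open>{p..<q}\<close> lie in an interval of
  length \<open>\<mu> {p..<q} + \<nu> {p..<q}\<close> (\<open>level_between\<close>). Adding over the dyadic cells of one generation and
  refining, the integral over all heights of the number of level points is at most \<open>\<mu> UNIV + \<nu> UNIV = 2\<close>
  (\<open>nn_integral_ecard_level_set\<close>).

  \<^bold>\<open>Almost every level consists of crossings.\<close> The suprema and infima of \<open>F\<close> over intervals with rational
  endpoints form a countable set of heights. At any other height no level point is a local extremum, so
  \<open>F - h\<close> takes both signs near each of them. Away from its level \<open>F - h\<close> has constant sign, and hence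
  the isolated points of the level are exactly the points of \<open>Graph_star_plus F\<close> and \<open>Graph_star_minus F\<close>
  (\<open>isolated_iff_crossing\<close>). On a finite level upward and downward crossings alternate, and since \<open>F\<close>
  vanishes at infinity there is an even number of them; \<open>F x\<close> lies beyond \<open>h\<close>, as seen from \<open>0\<close>, exactly
  when the number of level points up to \<open>x\<close> is odd (\<open>odd_rank_iff\<close>).

  \<^bold>\<open>Measurability.\<close> Outside the countable set of exceptional heights, the level meets an open interval
  iff \<open>F - h\<close> takes both signs at rational points of it (\<open>level_set_meets_iff\<close>). All quantities in the
  construction (number of level points, of isolated level points, position of the \<open>i\<close>-th level point) are
  countable combinations of such events.

  \<^bold>\<open>The marginals.\<close> Let \<open>\<rho>\<close> and \<open>\<rho>'\<close> be the first and second marginal of the coupling. The density \<open>N / 2\<close>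
  of the law of the height cancels the normalization of the uniform law on the \<open>N / 2\<close> pairs, so \<open>\<rho>\<close> and
  \<open>\<rho>'\<close> integrate over \<open>h\<close> the counting measures on the first and on the second components. Comparing the
  two on \<open>{..x}\<close>, the pairs with both components on the same side of \<open>x\<close> cancel, and by the parity rule
  at most one pair remains, namely when \<open>h\<close> lies between \<open>0\<close> and \<open>F x\<close>. Integration gives
  \<open>\<rho> {..x} - \<rho>' {..x} = F x\<close>, hence \<open>\<rho> - \<rho>' = \<mu> - \<nu>\<close> (\<open>marginals_add\<close>). As \<open>\<mu>\<close> and \<open>\<nu>\<close> are mutually
  singular, \<open>\<mu> \<le> \<rho>\<close> and \<open>\<nu> \<le> \<rho>'\<close> (\<open>mutually_singular_minimal\<close>). The total mass of \<open>\<rho>\<close> and of \<open>\<rho>'\<close> is at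
  most \<open>1\<close> by the first step, so both inequalities are equalities (\<open>marginals_coupling\<close>), and the law
  of the height has total mass \<open>1\<close>.

  \<^bold>\<open>The general case.\<close> A Hahn decomposition of \<open>\<mu> - \<nu>\<close> yields the common part, and its uniqueness is
  again the minimality of the Jordan decomposition. The marginals of the mixture are the sums of the
  marginals of its two summands.
\<close>

section \<open>Counting points of the line by dyadic cells\<close>

abbreviation ecard :: "'b set \<Rightarrow> ennreal" where
  "ecard A \<equiv> emeasure (count_space UNIV) A"

lemma ecard_leI:
  assumes "\<And>T. finite T \<Longrightarrow> T \<subseteq> A \<Longrightarrow> of_nat (card T) \<le> c"
  shows "ecard A \<le> c"
proof (cases "finite A")
  case True
  then show ?thesis using assms[of A] by simp
next
  case False
  have "of_nat n \<le> c" for n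
    using infinite_arbitrarily_large[OF False, of n] assms by auto
  then have "c = top"
    using ennreal_SUP_of_nat_eq_top by (metis SUP_least top.extremum_uniqueI)
  then show ?thesis by simp
qed

lemma card_le_ecard:
  assumes "finite T" "inj_on f T" "f ` T \<subseteq> B"
  shows "of_nat (card T) \<le> ecard B"
proof -
  have "of_nat (card T) = ecard (f ` T)"
    using assms by (simp add: card_image)
  also have "\<dots> \<le> ecard B"
    by (rule emeasure_mono[OF assms(3)]) simp
  finally show ?thesis .
qed

lemma ecard_le_inj:
  assumes "inj_on f A" "f ` A \<subseteq> B"
  shows "ecard A \<le> ecard B"
  using assms by (intro ecard_leI card_le_ecard[where f=f]) (auto intro: inj_on_subset)

text \<open>The dyadic cells of generation \<open>k\<close> are the fibres of this map, so \<open>dyadic_index k ` L\<close> is the set of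
  cells of that generation that meet \<open>L\<close>.\<close>

definition dyadic_index :: "nat \<Rightarrow> real \<Rightarrow> int" where
  "dyadic_index k x = \<lfloor>2 ^ k * x\<rfloor>"

lemma dyadic_index_eq_iff:
  "dyadic_index k x = i \<longleftrightarrow> x \<in> {real_of_int i / 2 ^ k ..< (real_of_int i + 1) / 2 ^ k}"
  unfolding dyadic_index_def floor_eq_iff by (auto simp: field_simps)

lemma dyadic_index_Suc: "dyadic_index k x = dyadic_index (Suc k) x div 2"
proof -
  have "\<lfloor>2 ^ k * x\<rfloor> = \<lfloor>(2 * 2 ^ k * x) / real_of_int 2\<rfloor>" by simp
  also have "\<dots> = \<lfloor>2 * 2 ^ k * x\<rfloor> div 2" by (rule floor_divide_real_eq_div) simp
  finally show ?thesis by (simp add: dyadic_index_def)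
qed

lemma dyadic_index_close:
  assumes "dyadic_index k x = dyadic_index k y"
  shows "\<bar>x - y\<bar> < 1 / 2 ^ k"
  using iffD1[OF dyadic_index_eq_iff refl, of x k] iffD1[OF dyadic_index_eq_iff assms[symmetric]]
  by (auto simp: add_divide_distrib)

lemma half_power_less:
  assumes "(0::real) < d"
  shows "\<exists>k. 1 / 2 ^ k < d"
  using real_arch_pow_inv[OF assms, of "1/2"] by (auto simp: power_one_over)

lemma finite_set_separated:
  fixes T :: "real set"
  assumes "finite T"
  shows "\<exists>d>0. \<forall>x\<in>T. \<forall>y\<in>T. x \<noteq> y \<longrightarrow> d \<le> \<bar>x - y\<bar>"
proof -
  have "\<forall>x\<in>T. \<exists>d>0. \<forall>y\<in>T. x \<noteq> y \<longrightarrow> d \<le> \<bar>x - y\<bar>"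
  proof
    fix x
    obtain d where "d > 0" "\<forall>y\<in>T. y \<noteq> x \<longrightarrow> d \<le> dist x y"
      using finite_set_avoid[OF assms, of x] by auto
    then show "\<exists>d>0. \<forall>y\<in>T. x \<noteq> y \<longrightarrow> d \<le> \<bar>x - y\<bar>"
      unfolding dist_real_def by (intro exI[of _ d]) auto
  qed
  then obtain d where d: "\<And>x. x \<in> T \<Longrightarrow> d x > 0" "\<And>x y. x \<in> T \<Longrightarrow> y \<in> T \<Longrightarrow> x \<noteq> y \<Longrightarrow> d x \<le> \<bar>x - y\<bar>"
    by metis
  show ?thesis
    using assms d by (intro exI[of _ "Min (insert 1 (d ` T))"]) (auto simp: Min_le_iff)
qed

text \<open>A finite subset of \<open>L\<close> is separated by the cells of a fine enough generation, and every cell that meets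
  \<open>L\<close> contributes at least one point. This reduces the number of points of a level to the events that
  the level meets a given cell.\<close>

lemma ecard_eq_SUP_dyadic:
  "ecard L = (SUP k. ecard (dyadic_index k ` L))"
proof (rule antisym)
  show "ecard L \<le> (SUP k. ecard (dyadic_index k ` L))"
  proof (rule ecard_leI)
    fix T assume T: "finite T" "T \<subseteq> L"
    obtain d where d: "d > 0" "\<And>x y. x \<in> T \<Longrightarrow> y \<in> T \<Longrightarrow> x \<noteq> y \<Longrightarrow> d \<le> \<bar>x - y\<bar>"
      using finite_set_separated[OF T(1)] by blast
    obtain k where k: "1 / 2 ^ k < d" using half_power_less[OF d(1)] by blast
    have "inj_on (dyadic_index k) T"
    proof (rule inj_onI, rule ccontr)
      fix x y assume "x \<in> T" "y \<in> T" "dyadic_index k x = dyadic_index k y" "x \<noteq> y"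
      with dyadic_index_close[of k x y] d(2)[of x y] k show False by auto
    qed
    with T have "of_nat (card T) \<le> ecard (dyadic_index k ` L)"
      by (intro card_le_ecard[where f="dyadic_index k"]) auto
    also have "\<dots> \<le> (SUP k. ecard (dyadic_index k ` L))" by (rule SUP_upper) simp
    finally show "of_nat (card T) \<le> (SUP k. ecard (dyadic_index k ` L))" .
  qed
  have "ecard (dyadic_index k ` L) \<le> ecard L" for k
    by (intro ecard_le_inj[where f="inv_into L (dyadic_index k)"])
       (auto intro: inj_on_inv_into inv_into_into)
  then show "(SUP k. ecard (dyadic_index k ` L)) \<le> ecard L" by (auto intro: SUP_least)
qed

text \<open>Each cell is the union of two cells of the next generation.\<close>

lemma incseq_ecard_dyadic: "incseq (\<lambda>k. ecard (dyadic_index k ` L))"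
proof (rule incseq_SucI)
  fix k
  have "dyadic_index k ` L = (\<lambda>i. i div 2) ` dyadic_index (Suc k) ` L"
    by (simp add: image_image flip: dyadic_index_Suc)
  then show "ecard (dyadic_index k ` L) \<le> ecard (dyadic_index (Suc k) ` L)"
    by (intro ecard_le_inj[where f="inv_into (dyadic_index (Suc k) ` L) (\<lambda>i. i div 2)"])
       (auto intro!: inj_on_inv_into inv_into_into)
qed

definition isolated_points :: "real set \<Rightarrow> real set" where
  "isolated_points L = {x. \<exists>d>0. L \<inter> {x - d<..<x + d} = {x}}"

text \<open>The window consists of the cell \<open>i\<close> and its two neighbours. A point may be alone in its own half-open
  cell and still be an accumulation point of \<open>L\<close> from the left of the cell; a window with only one point of
  \<open>L\<close> contains a whole neighbourhood of the point in its middle cell and excludes this.\<close>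

definition isolating_indices :: "nat \<Rightarrow> real set \<Rightarrow> int set" where
  "isolating_indices k L = {i. i \<in> dyadic_index k ` L \<and>
     ecard (L \<inter> {(real_of_int i - 1) / 2 ^ k ..< (real_of_int i + 2) / 2 ^ k}) = 1}"

lemma ecard_eq_1_iff: "ecard A = 1 \<longleftrightarrow> (\<exists>x. A = {x})"
proof
  assume *: "ecard A = 1"
  then have "finite A" using emeasure_count_space_infinite[of A UNIV] by force
  with * have "card A = 1" by simp
  then show "\<exists>x. A = {x}" by (auto simp: card_1_singleton_iff)
qed auto

lemma dyadic_window_bounds:
  "{x - 1 / 2 ^ k<..<x + 1 / 2 ^ k} \<subseteq>
     {(real_of_int (dyadic_index k x) - 1) / 2 ^ k ..< (real_of_int (dyadic_index k x) + 2) / 2 ^ k}"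
  "{(real_of_int (dyadic_index k x) - 1) / 2 ^ k ..< (real_of_int (dyadic_index k x) + 2) / 2 ^ k}
     \<subseteq> {x - 2 / 2 ^ k..x + 2 / 2 ^ k}"
  using dyadic_index_eq_iff[of k x "dyadic_index k x"]
  by (auto simp: add_divide_distrib diff_divide_distrib)

text \<open>Finitely many isolated points have a common radius of isolation, and windows of a fine enough generation
  are smaller than that. Conversely, a cell in the middle of a one-point window contains an isolated
  point of its own.\<close>

lemma ecard_isolated_eq_SUP:
  "ecard (isolated_points L) = (SUP k. ecard (isolating_indices k L))"
proof (rule antisym)
  show "ecard (isolated_points L) \<le> (SUP k. ecard (isolating_indices k L))"
  proof (rule ecard_leI)
    fix T assume T: "finite T" "T \<subseteq> isolated_points L"
    have "\<forall>x\<in>T. \<exists>d>0. L \<inter> {x - d<..<x + d} = {x}"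
      using T by (auto simp: isolated_points_def)
    then obtain d where d: "\<And>x. x \<in> T \<Longrightarrow> d x > 0" "\<And>x. x \<in> T \<Longrightarrow> L \<inter> {x - d x<..<x + d x} = {x}"
      by metis
    \<comment> \<open>The window around \<open>x\<close> reaches at most two cells beyond \<open>x\<close>, so \<open>2 / 2 ^ k\<close> must stay below every radius.\<close>
    have "Min (insert 1 (d ` T)) > 0" using T d by auto
    then have "Min (insert 1 (d ` T)) / 2 > 0" by simp
    then obtain k where k: "1 / 2 ^ k < Min (insert 1 (d ` T)) / 2" using half_power_less by blast
    have small: "2 / 2 ^ k < d x" if "x \<in> T" for x
    proof -
      have "Min (insert 1 (d ` T)) \<le> d x" using T(1) that by (intro Min_le) auto
      with k show ?thesis by simp
    qed
    have TL: "T \<subseteq> L" using d(2) by blast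
    have inj: "inj_on (dyadic_index k) T"
    proof (rule inj_onI)
      fix x y assume xy: "x \<in> T" "y \<in> T" "dyadic_index k x = dyadic_index k y"
      have "\<bar>x - y\<bar> < 1 / 2 ^ k" by (rule dyadic_index_close) fact
      moreover have "1 / 2 ^ k < d x"
        using small[OF xy(1)] by (meson divide_right_mono less_le_trans not_le one_le_numeral zero_le_numeral zero_le_power)
      ultimately have "y \<in> L \<inter> {x - d x<..<x + d x}" using xy TL by auto
      with d(2)[OF xy(1)] show "x = y" by auto
    qed
    have "dyadic_index k x \<in> isolating_indices k L" if "x \<in> T" for x
    proof -
      let ?W = "{(real_of_int (dyadic_index k x) - 1) / 2 ^ k ..< (real_of_int (dyadic_index k x) + 2) / 2 ^ k}"
      have "?W \<subseteq> {x - d x<..<x + d x}"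
        using dyadic_window_bounds(2)[of k x] small[OF that] by (force simp del: atLeastatMost_subset_iff)
      moreover have "x \<in> ?W"
        by (rule subsetD[OF dyadic_window_bounds(1)]) auto
      ultimately have "L \<inter> ?W = {x}" using d(2)[OF that] by blast
      then show ?thesis using TL that by (auto simp: isolating_indices_def)
    qed
    then have "of_nat (card T) \<le> ecard (isolating_indices k L)"
      using T inj by (intro card_le_ecard[where f="dyadic_index k"]) auto
    also have "\<dots> \<le> (SUP k. ecard (isolating_indices k L))" by (rule SUP_upper) simp
    finally show "of_nat (card T) \<le> (SUP k. ecard (isolating_indices k L))" .
  qed
  have "ecard (isolating_indices k L) \<le> ecard (isolated_points L)" for k
  proof (rule ecard_le_inj)
    let ?g = "inv_into L (dyadic_index k)"
    show "inj_on ?g (isolating_indices k L)"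
      by (rule inj_on_inv_into) (auto simp: isolating_indices_def)
    show "?g ` isolating_indices k L \<subseteq> isolated_points L"
    proof safe
      fix i assume i: "i \<in> isolating_indices k L"
      then have x: "?g i \<in> L" "dyadic_index k (?g i) = i"
        by (auto simp: isolating_indices_def inv_into_into f_inv_into_f)
      obtain y where y: "L \<inter> {(real_of_int i - 1) / 2 ^ k ..< (real_of_int i + 2) / 2 ^ k} = {y}"
        using i by (auto simp: isolating_indices_def ecard_eq_1_iff)
      have sub: "{?g i - 1 / 2 ^ k<..<?g i + 1 / 2 ^ k} \<subseteq> {(real_of_int i - 1) / 2 ^ k ..< (real_of_int i + 2) / 2 ^ k}"
        using dyadic_window_bounds(1)[of "?g i" k] x(2) by simp
      have "?g i \<in> {?g i - 1 / 2 ^ k<..<?g i + 1 / 2 ^ k}" by simp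
      with sub x(1) have "?g i \<in> L \<inter> {(real_of_int i - 1) / 2 ^ k ..< (real_of_int i + 2) / 2 ^ k}" by blast
      with y have "y = ?g i" by simp
      have "L \<inter> {?g i - 1 / 2 ^ k<..<?g i + 1 / 2 ^ k} \<subseteq> {?g i}"
        using sub y unfolding \<open>y = ?g i\<close> by blast
      with x(1) have "L \<inter> {?g i - 1 / 2 ^ k<..<?g i + 1 / 2 ^ k} = {?g i}" by auto
      then show "?g i \<in> isolated_points L"
        unfolding isolated_points_def by (auto intro!: exI[of _ "1 / 2 ^ k"])
    qed
  qed
  then show "(SUP k. ecard (isolating_indices k L)) \<le> ecard (isolated_points L)"
    by (auto intro: SUP_least)
qed

text \<open>As a series, the cardinality of a subset of a countable type inherits measurability and monotone
  convergence from its terms.\<close>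

lemma ecard_Collect_eq_suminf:
  fixes Q :: "'i :: countable \<Rightarrow> bool"
  shows "ecard {i. Q i} = (\<Sum>n. if \<exists>i. to_nat i = n \<and> Q i then 1 else 0)"
proof -
  have "ecard {i. Q i} = ecard (to_nat ` {i. Q i})"
    by (rule antisym; rule ecard_le_inj[where f=to_nat] ecard_le_inj[where f=from_nat]) (auto intro: inj_onI)
  also have "\<dots> = (\<integral>\<^sup>+n. indicator (to_nat ` {i. Q i}) n \<partial>count_space UNIV)" by simp
  also have "\<dots> = (\<Sum>n. indicator (to_nat ` {i. Q i}) n)" by (rule nn_integral_count_space_nat)
  also have "\<dots> = (\<Sum>n. if \<exists>i. to_nat i = n \<and> Q i then 1 else 0)"
    by (intro suminf_cong) (auto simp: indicator_def)
  finally show ?thesis .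
qed

lemma borel_measurable_ecard:
  fixes Q :: "'a \<Rightarrow> 'i :: countable \<Rightarrow> bool"
  assumes [measurable]: "\<And>i. Measurable.pred M (\<lambda>x. Q x i)"
  shows "(\<lambda>x. ecard {i. Q x i}) \<in> borel_measurable M"
  unfolding ecard_Collect_eq_suminf by measurable

text \<open>By Tonelli the integral of a number of events is the sum of their measures, and a bound of these by the
  measures of disjoint sets adds up to the total mass.\<close>

lemma nn_integral_ecard_le:
  fixes Q :: "'a \<Rightarrow> 'i :: countable \<Rightarrow> bool" and I :: "'i \<Rightarrow> 'b set"
  assumes [measurable]: "\<And>i. Measurable.pred M (\<lambda>x. Q x i)"
    and le: "\<And>i. emeasure M {x \<in> space M. Q x i} \<le> emeasure N (I i) + emeasure N' (I i)"
    and I: "\<And>i. I i \<in> sets N" "\<And>i. I i \<in> sets N'" "disjoint_family I"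
  shows "(\<integral>\<^sup>+x. ecard {i. Q x i} \<partial>M) \<le> emeasure N (space N) + emeasure N' (space N')"
proof -
  \<comment> \<open>The sets \<open>I i\<close> indexed by natural numbers, with \<open>{}\<close> at numbers that encode no index.\<close>
  let ?J = "\<lambda>n. \<Union>i\<in>{i. to_nat i = n}. I i"
  have J: "?J (to_nat i) = I i" for i by auto
  have J0: "?J n = {}" if "\<not> (\<exists>i::'i. to_nat i = n)" for n using that by auto
  have dis: "disjoint_family ?J"
  proof (unfold disjoint_family_on_def, intro ballI impI)
    fix m n :: nat assume "m \<noteq> n"
    then have "I i \<inter> I j = {}" if "to_nat i = m" "to_nat j = n" for i j
      using that I(3) unfolding disjoint_family_on_def by (metis UNIV_I)
    then show "?J m \<inter> ?J n = {}" by auto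
  qed
  have total: "(\<Sum>n. emeasure R (?J n)) \<le> emeasure R (space R)" if "\<And>i. I i \<in> sets R" for R
  proof -
    have "?J n \<in> sets R" for n
      using J J0 that by (cases "\<exists>i::'i. to_nat i = n") (metis, simp)
    then have "(\<Sum>n. emeasure R (?J n)) = emeasure R (\<Union>n. ?J n)"
      using dis by (intro suminf_emeasure) auto
    also have "\<dots> \<le> emeasure R (space R)" by (rule emeasure_space)
    finally show ?thesis .
  qed
  have "(\<integral>\<^sup>+x. ecard {i. Q x i} \<partial>M) = (\<Sum>n. \<integral>\<^sup>+x. (if \<exists>i. to_nat i = n \<and> Q x i then 1 else 0) \<partial>M)"
    unfolding ecard_Collect_eq_suminf by (rule nn_integral_suminf) measurable
  also have "\<dots> \<le> (\<Sum>n. emeasure N (?J n) + emeasure N' (?J n))"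
  proof (intro suminf_le)
    fix n
    show "(\<integral>\<^sup>+x. (if \<exists>i. to_nat i = n \<and> Q x i then 1 else 0) \<partial>M) \<le> emeasure N (?J n) + emeasure N' (?J n)"
    proof (cases "\<exists>i::'i. to_nat i = n")
      case True
      then obtain i :: 'i where i: "to_nat i = n" by auto
      have "(\<integral>\<^sup>+x. (if \<exists>i. to_nat i = n \<and> Q x i then 1 else 0) \<partial>M)
          = (\<integral>\<^sup>+x. indicator {x \<in> space M. Q x i} x \<partial>M)"
        using i by (intro nn_integral_cong) (auto simp: indicator_def)
      also have "\<dots> = emeasure M {x \<in> space M. Q x i}" by (rule nn_integral_indicator) measurable
      also have "\<dots> \<le> emeasure N (?J n) + emeasure N' (?J n)" using le[of i] J[of i] i by simp
      finally show ?thesis .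
    next
      case False
      then have "(\<lambda>x. if \<exists>i. to_nat i = n \<and> Q x i then 1 else 0) = (\<lambda>x. 0::ennreal)" by auto
      then show ?thesis by simp
    qed
  qed auto
  also have "\<dots> = (\<Sum>n. emeasure N (?J n)) + (\<Sum>n. emeasure N' (?J n))"
    by (rule suminf_add[symmetric]) auto
  also have "\<dots> \<le> emeasure N (space N) + emeasure N' (space N')"
    using I by (intro add_mono total) auto
  finally show ?thesis .
qed

section \<open>Levels of a cadlag function\<close>

abbreviation level_set :: "(real \<Rightarrow> real) \<Rightarrow> real \<Rightarrow> real set" where
  "level_set F h \<equiv> {x. (x, h) \<in> Graph_star F}"

text \<open>Every value of \<open>f\<close> at a strict or non-strict local maximum is the supremum of \<open>f\<close> over some interval with
  rational endpoints; the set is countable because there are only countably many such intervals.\<close>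

definition peaks :: "(real \<Rightarrow> real) \<Rightarrow> real set" where
  "peaks f = (\<lambda>(p, q). Sup (f ` {p<..<q})) ` (\<rat> \<times> \<rat>)"

lemma countable_peaks: "countable (peaks f)"
  unfolding peaks_def by (intro countable_image countable_SIGMA countable_rat)

text \<open>If \<open>f\<close> did not exceed \<open>h\<close> near \<open>y\<close> except possibly at \<open>y\<close>, then neither \<open>f y\<close> nor the left limit would, as
  limits of such values. The point \<open>h\<close> of the segment between them would then be the larger of the two, which
  is the supremum of \<open>f\<close> over a small rational interval around \<open>y\<close>, that is, a peak.\<close>

lemma not_peak_exceeded:
  fixes f :: "real \<Rightarrow> real"
  assumes right: "(f \<longlongrightarrow> f y) (at_right y)" and left: "(f \<longlongrightarrow> l) (at_left y)"
    and h: "h \<in> closed_segment l (f y)" "h \<notin> peaks f" and pq: "p < y" "y < q"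
  shows "\<exists>u. p < u \<and> u < q \<and> u \<noteq> y \<and> h < f u"
proof (rule ccontr)
  assume "\<not> ?thesis"
  then have le: "f u \<le> h" if "p < u" "u < q" "u \<noteq> y" for u using that by force
  have ev_right: "eventually (\<lambda>u. P u) (at_right y)" if "\<And>u. y < u \<Longrightarrow> u < q \<Longrightarrow> P u" for P
    using that pq(2) by (auto simp: eventually_at_right)
  have ev_left: "eventually (\<lambda>u. P u) (at_left y)" if "\<And>u. p < u \<Longrightarrow> u < y \<Longrightarrow> P u" for P
    using that pq(1) by (auto simp: eventually_at_left)
  have fy: "f y \<le> h"
    using pq le by (intro tendsto_upperbound[OF right] ev_right) auto
  have l: "l \<le> h"
    using pq le by (intro tendsto_upperbound[OF left] ev_left) auto
  from h(1) fy l have eq: "h = f y \<or> h = l"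
    by (auto simp: closed_segment_eq_real_ivl split: if_splits)
  obtain p' where p': "p' \<in> \<rat>" "p < p'" "p' < y" using Rats_dense_in_real[OF pq(1)] by blast
  obtain q' where q': "q' \<in> \<rat>" "y < q'" "q' < q" using Rats_dense_in_real[OF pq(2)] by blast
  have "Sup (f ` {p'<..<q'}) = h"
  proof (rule cSup_eq)
    fix v assume "v \<in> f ` {p'<..<q'}"
    then obtain u where "p' < u" "u < q'" "v = f u" by auto
    then show "v \<le> h" using le[of u] fy p' q' by (cases "u = y") auto
  next
    fix z assume z: "\<And>v. v \<in> f ` {p'<..<q'} \<Longrightarrow> v \<le> z"
    have "f y \<le> z" using z p' q' by auto
    moreover have "l \<le> z"
    proof (rule tendsto_upperbound[OF left])
      show "\<forall>\<^sub>F i in at_left y. f i \<le> z"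
        using z p' q' by (auto simp: eventually_at_left intro!: exI[of _ p'])
    qed simp
    ultimately show "h \<le> z" using eq by auto
  qed
  then have "h \<in> peaks f" using p' q' unfolding peaks_def by force
  with h(2) show False by simp
qed

text \<open>The facts on levels, up to and including the excursion kernel, use only that \<open>F\<close> is a cadlag function with left limits
  \<open>Fl\<close> that vanishes at both infinities.\<close>

locale cadlag_excursion =
  fixes F Fl :: "real \<Rightarrow> real"
  assumes right_cont: "\<And>x. (F \<longlongrightarrow> F x) (at_right x)"
    and left_lim: "\<And>x. (F \<longlongrightarrow> Fl x) (at_left x)"
    and lim_bot: "(F \<longlongrightarrow> 0) at_bot"
    and lim_top: "(F \<longlongrightarrow> 0) at_top"
begin

text \<open>At a continuity point the left limit is the value, and the segment degenerates to that value.\<close>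

lemma F_star_eq: "F_star F x = closed_segment (Fl x) (F x)"
proof (cases "isCont F x")
  case True
  then have "(F \<longlongrightarrow> F x) (at_left x)"
    by (auto simp: isCont_def intro: filterlim_mono at_le)
  then have "Fl x = F x" using left_lim[of x] by (intro tendsto_unique[of "at_left x"]) auto
  with True show ?thesis by (simp add: F_star_def)
next
  case False
  have "Lim (at_left x) F = Fl x" by (rule tendsto_Lim[OF _ left_lim]) simp
  with False show ?thesis by (simp add: F_star_def)
qed

lemma mem_Graph_star: "(x, h) \<in> Graph_star F \<longleftrightarrow> h \<in> closed_segment (Fl x) (F x)"
  by (simp add: Graph_star_def F_star_eq)

lemma F_mem_Graph_star: "(x, F x) \<in> Graph_star F"
  by (simp add: mem_Graph_star)

text \<open>This countable set contains the heights of all local extrema of \<open>F\<close>, where a level may touch the graph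
  without crossing it, and the height \<open>0\<close>, which \<open>F\<close> approaches at infinity.\<close>

definition exceptional :: "real set" where
  "exceptional = {0} \<union> peaks F \<union> uminus ` peaks (\<lambda>x. - F x)"

lemma countable_exceptional: "countable exceptional"
  by (auto simp: exceptional_def intro: countable_peaks)

lemma exceeded_near_level:
  assumes "h \<notin> exceptional" "(y, h) \<in> Graph_star F" "p < y" "y < q"
  shows "\<exists>u. p < u \<and> u < q \<and> u \<noteq> y \<and> h < F u"
  using assms right_cont left_lim
  by (intro not_peak_exceeded[where l="Fl y"]) (auto simp: exceptional_def mem_Graph_star)

text \<open>This is \<open>exceeded_near_level\<close> for \<open>- F\<close> at the height \<open>- h\<close>.\<close>

lemma undercut_near_level:
  assumes "h \<notin> exceptional" "(y, h) \<in> Graph_star F" "p < y" "y < q"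
  shows "\<exists>u. p < u \<and> u < q \<and> u \<noteq> y \<and> F u < h"
proof -
  have "- h \<notin> peaks (\<lambda>x. - F x)" using assms(1) by (force simp: exceptional_def)
  then have "\<exists>u. p < u \<and> u < q \<and> u \<noteq> y \<and> - h < - F u"
    using assms right_cont left_lim
    by (intro not_peak_exceeded[where l="- Fl y"] tendsto_minus)
       (auto simp: mem_Graph_star closed_segment_eq_real_ivl split: if_splits)
  then show ?thesis by simp
qed

text \<open>Right continuity turns a strict inequality at one point into the same inequality on an interval, and
  hence at a rational point (\<open>rational_value\<close>).\<close>

lemma right_neighbourhood:
  assumes "open S" "F u \<in> S" "u < q"
  shows "\<exists>v>u. v < q \<and> (\<forall>w\<in>{u..v}. F w \<in> S)"
proof -
  have "eventually (\<lambda>w. F w \<in> S) (at_right u)"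
    using right_cont assms by (simp add: tendsto_def)
  then obtain b where b: "b > u" "\<And>w. u < w \<Longrightarrow> w < b \<Longrightarrow> F w \<in> S"
    by (auto simp: eventually_at_right[of u "u + 1"])
  obtain v where "u < v" "v < min b q" using dense[of u "min b q"] b assms by auto
  with b assms show ?thesis
    by (intro exI[of _ v]) (auto simp: le_less)
qed

lemma rational_value:
  assumes "open S" "F u \<in> S" "p < u" "u < q"
  shows "\<exists>r\<in>\<rat>. p < r \<and> r < q \<and> F r \<in> S"
proof -
  obtain v where v: "u < v" "v < q" "\<forall>w\<in>{u..v}. F w \<in> S"
    using right_neighbourhood[OF assms(1,2,4)] by blast
  obtain r where "r \<in> \<rat>" "u < r" "r < v" using Rats_dense_in_real[OF v(1)] by blast
  with v assms show ?thesis by (intro bexI[of _ r]) auto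
qed

text \<open>At a point off the level, the value and the left limit of \<open>F\<close> lie strictly on the same side of \<open>h\<close>.\<close>

lemma side_constant_near:
  assumes "(x, h) \<notin> Graph_star F"
  shows "\<exists>d>0. \<forall>y. \<bar>y - x\<bar> < d \<longrightarrow> (F y < h \<longleftrightarrow> F x < h)"
proof -
  have sides: "h \<noteq> F x" "h \<noteq> Fl x" "F x < h \<longleftrightarrow> Fl x < h"
    using assms by (auto simp: mem_Graph_star closed_segment_eq_real_ivl split: if_splits)
  have "eventually (\<lambda>y. F y < h \<longleftrightarrow> F x < h) (at_right x)"
    using order_tendstoD[OF right_cont, of h x] order_tendstoD(2)[OF right_cont, of x h] sides(1)
    by (cases "F x < h") (auto elim: eventually_mono)
  moreover have "eventually (\<lambda>y. F y < h \<longleftrightarrow> F x < h) (at_left x)"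
    using order_tendstoD(1)[OF left_lim, of h x] order_tendstoD(2)[OF left_lim, of x h] sides
    by (cases "Fl x < h") (auto elim: eventually_mono)
  ultimately have "eventually (\<lambda>y. F y < h \<longleftrightarrow> F x < h) (at x)"
    by (simp add: eventually_at_split)
  then obtain d where "d > 0" "\<And>y. y \<noteq> x \<Longrightarrow> dist y x < d \<Longrightarrow> F y < h \<longleftrightarrow> F x < h"
    by (auto simp: eventually_at)
  then show ?thesis by (intro exI[of _ d]) (metis dist_real_def)
qed

text \<open>The intermediate value theorem for the graph completed by the vertical segments at the jumps: \<open>F\<close> cannot
  pass from one side of \<open>h\<close> to the other without meeting the level. The local statement is
  \<open>side_constant_near\<close>, and compactness of \<open>{a..b}\<close> makes it global.\<close>

lemma side_constant:
  assumes "a \<le> b" "{a..b} \<inter> level_set F h = {}"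
  shows "F a < h \<longleftrightarrow> F b < h"
proof (rule Bolzano[where P="\<lambda>a b. F a < h \<longleftrightarrow> F b < h"])
  fix x assume "a \<le> x" "x \<le> b"
  with assms have "(x, h) \<notin> Graph_star F" by auto
  from side_constant_near[OF this] show "\<exists>d>0. \<forall>a b. a \<le> x \<and> x \<le> b \<and> b - a < d \<longrightarrow> (F a < h) = (F b < h)"
    by (smt (verit))
qed (use assms in auto)

text \<open>A level point is not a local extremum, so both signs of \<open>F - h\<close> occur next to it, and by right continuity
  also at rational points. Conversely a change of sign forces a level point in between.\<close>

lemma level_set_meets_iff:
  assumes "h \<notin> exceptional"
  shows "level_set F h \<inter> {p<..<q} \<noteq> {} \<longleftrightarrow>
    (\<exists>r\<in>\<rat>. p < r \<and> r < q \<and> F r < h) \<and> (\<exists>s\<in>\<rat>. p < s \<and> s < q \<and> h < F s)"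
proof
  assume "level_set F h \<inter> {p<..<q} \<noteq> {}"
  then obtain y where y: "(y, h) \<in> Graph_star F" "p < y" "y < q" by auto
  from exceeded_near_level[OF assms y] undercut_near_level[OF assms y]
  show "(\<exists>r\<in>\<rat>. p < r \<and> r < q \<and> F r < h) \<and> (\<exists>s\<in>\<rat>. p < s \<and> s < q \<and> h < F s)"
    using rational_value[of "{..<h}"] rational_value[of "{h<..}"] by auto
next
  assume "(\<exists>r\<in>\<rat>. p < r \<and> r < q \<and> F r < h) \<and> (\<exists>s\<in>\<rat>. p < s \<and> s < q \<and> h < F s)"
  then obtain r s where rs: "p < r" "r < q" "F r < h" "p < s" "s < q" "h < F s" by auto
  show "level_set F h \<inter> {p<..<q} \<noteq> {}"
  proof
    assume *: "level_set F h \<inter> {p<..<q} = {}"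
    have "{min r s..max r s} \<subseteq> {p<..<q}" using rs by auto
    with * have no_level: "{min r s..max r s} \<inter> level_set F h = {}" by blast
    show False
    proof (cases "r \<le> s")
      case True
      with no_level side_constant[of r s h] rs show False by (simp add: min_def max_def)
    next
      case False
      with no_level side_constant[of s r h] rs show False by (simp add: min_def max_def)
    qed
  qed
qed

text \<open>For the open interval \<open>level_set_meets_iff\<close> gives a countable combination of half-lines, up to the
  countable set of exceptional heights; the endpoint \<open>p\<close> adds a closed segment of heights.\<close>

lemma sets_level_set_meets:
  "{h. level_set F h \<inter> {p..<q} \<noteq> {}} \<in> sets borel"
proof (cases "p < q")
  case True
  let ?A = "{h. h \<in> closed_segment (Fl p) (F p)}"
  let ?B = "(\<Union>r\<in>{r\<in>\<rat>. p < r \<and> r < q}. {F r<..}) \<inter> (\<Union>s\<in>{s\<in>\<rat>. p < s \<and> s < q}. {..<F s})"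
  let ?S = "{h. level_set F h \<inter> {p..<q} \<noteq> {}}"
  have iff: "h \<in> ?S \<longleftrightarrow> h \<in> ?A \<or> level_set F h \<inter> {p<..<q} \<noteq> {}" for h
    using True by (auto simp: mem_Graph_star[symmetric] le_less)
  have *: "?S = (?S \<inter> exceptional) \<union> ((?A \<union> ?B) - exceptional)"
  proof (rule set_eqI)
    fix h
    show "h \<in> ?S \<longleftrightarrow> h \<in> (?S \<inter> exceptional) \<union> ((?A \<union> ?B) - exceptional)"
      using iff[of h] level_set_meets_iff[of h p q] by (cases "h \<in> exceptional") auto
  qed
  have ctb: "countable {r\<in>\<rat>. p < r \<and> r < q}" by (rule countable_subset[OF _ countable_rat]) auto
  have "?S \<inter> exceptional \<in> sets borel"
    by (rule sets.countable) (auto intro: countable_subset[OF _ countable_exceptional])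
  moreover have "exceptional \<in> sets borel"
    by (rule sets.countable) (auto intro: countable_exceptional)
  moreover have "?A \<in> sets borel" by (simp add: closed_segment_eq_real_ivl)
  moreover have "?B \<in> sets borel" using ctb by (intro sets.Int sets.countable_UN') auto
  ultimately show ?thesis by (subst *) auto
next
  case False
  then show ?thesis by simp
qed

text \<open>The hypothesis holds for half-lines and intervals of the form \<open>{p..<q}\<close>: they cut each dyadic cell in an
  interval of the same form, which is what \<open>sets_level_set_meets\<close> needs.\<close>

lemma borel_measurable_ecard_level:
  assumes B: "\<And>p q. \<exists>p' q'. B \<inter> {p..<q} = {p'..<q'}"
  shows "(\<lambda>h. ecard (level_set F h \<inter> B)) \<in> borel_measurable borel"
proof -
  have "(\<lambda>h. ecard {i. i \<in> dyadic_index k ` (level_set F h \<inter> B)}) \<in> borel_measurable borel" for k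
  proof (rule borel_measurable_ecard)
    fix i
    obtain p q where pq: "B \<inter> {real_of_int i / 2 ^ k ..< (real_of_int i + 1) / 2 ^ k} = {p..<q}"
      using B by metis
    have "(i \<in> dyadic_index k ` (level_set F h \<inter> B)) \<longleftrightarrow> level_set F h \<inter> {p..<q} \<noteq> {}" for h
      unfolding pq[symmetric] image_iff
      by (auto simp: eq_commute[of i] dyadic_index_eq_iff)
    then show "Measurable.pred borel (\<lambda>h. i \<in> dyadic_index k ` (level_set F h \<inter> B))"
      using sets_level_set_meets[of p q] by (simp add: pred_def)
  qed
  then show ?thesis by (subst ecard_eq_SUP_dyadic) simp
qed

lemma borel_measurable_ecard_isolated:
  "(\<lambda>h. ecard (isolated_points (level_set F h))) \<in> borel_measurable borel"
proof -
  have "(\<lambda>h. ecard {i. i \<in> isolating_indices k (level_set F h)}) \<in> borel_measurable borel" for k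
  proof (rule borel_measurable_ecard)
    fix i
    have [measurable]: "(\<lambda>h. ecard (level_set F h \<inter> {(real_of_int i - 1) / 2 ^ k ..< (real_of_int i + 2) / 2 ^ k}))
        \<in> borel_measurable borel"
      by (rule borel_measurable_ecard_level) auto
    have "(i \<in> dyadic_index k ` level_set F h) \<longleftrightarrow>
      level_set F h \<inter> {real_of_int i / 2 ^ k ..< (real_of_int i + 1) / 2 ^ k} \<noteq> {}" for h
      by (auto simp: image_iff eq_commute[of i] dyadic_index_eq_iff)
    then have [measurable]: "Measurable.pred borel (\<lambda>h. i \<in> dyadic_index k ` level_set F h)"
      using sets_level_set_meets by (simp add: pred_def)
    show "Measurable.pred borel (\<lambda>h. i \<in> isolating_indices k (level_set F h))"
      unfolding isolating_indices_def mem_Collect_eq by measurable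
  qed
  then show ?thesis by (subst ecard_isolated_eq_SUP) simp
qed

text \<open>On each side of an isolated level point the sign of \<open>F - h\<close> is constant; it cannot be the same on both
  sides because the point is not a local extremum.\<close>

lemma crossing_sides:
  assumes h: "h \<notin> exceptional" and c: "level_set F h \<inter> {c - d<..<c + d} = {c}" "d > 0"
  shows "(\<forall>x. c - d < x \<and> x < c \<longrightarrow> F x < h) \<and> (\<forall>x. c < x \<and> x < c + d \<longrightarrow> h < F x) \<or>
         (\<forall>x. c - d < x \<and> x < c \<longrightarrow> h < F x) \<and> (\<forall>x. c < x \<and> x < c + d \<longrightarrow> F x < h)"
proof -
  have cL: "(c, h) \<in> Graph_star F" using c by auto
  have ne: "F x \<noteq> h" if "c - d < x" "x < c + d" "x \<noteq> c" for x
  proof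
    assume "F x = h"
    then have "x \<in> level_set F h \<inter> {c - d<..<c + d}" using F_mem_Graph_star[of x] that by auto
    with c that show False by auto
  qed
  have side: "F x < h \<longleftrightarrow> F y < h"
    if "x \<le> y" "c - d < x" "y < c + d" "y < c \<or> c < x" for x y
  proof (rule side_constant)
    show "{x..y} \<inter> level_set F h = {}"
    proof (rule equals0I)
      fix z assume z: "z \<in> {x..y} \<inter> level_set F h"
      then have "z \<in> level_set F h \<inter> {c - d<..<c + d}" using that by auto
      then have "z = c" unfolding c(1) by simp
      with z that show False by auto
    qed
  qed fact
  have side': "F x < h \<longleftrightarrow> F y < h"
    if "c - d < x" "c - d < y" "x < c + d" "y < c + d" "x < c \<and> y < c \<or> c < x \<and> c < y" for x y
  proof (cases "x \<le> y")
    case True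
    show ?thesis by (rule side[OF True]) (use that in blast)+
  next
    case False
    then have "y \<le> x" by simp
    show ?thesis by (rule side[OF \<open>y \<le> x\<close>, symmetric]) (use that in blast)+
  qed
  obtain u where u: "c - d < u" "u < c + d" "u \<noteq> c" "h < F u"
    using exceeded_near_level[OF h cL, of "c - d" "c + d"] c(2) by auto
  obtain v where v: "c - d < v" "v < c + d" "v \<noteq> c" "F v < h"
    using undercut_near_level[OF h cL, of "c - d" "c + d"] c(2) by auto
  show ?thesis
  proof (cases "u < c")
    case True
    then have left: "h < F x" if "c - d < x" "x < c" for x
      using side'[of x u] ne[of x] that u by force
    then have "c < v" using v by force
    then have "F x < h" if "c < x" "x < c + d" for x
      using side'[of x v] that v by force
    with left show ?thesis by blast
  next
    case False
    then have right: "h < F x" if "c < x" "x < c + d" for x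
      using side'[of x u] ne[of x] that u by force
    then have "v < c" using v by force
    then have "F x < h" if "c - d < x" "x < c" for x
      using side'[of x v] that v by force
    with right show ?thesis by blast
  qed
qed

text \<open>Off the level the segment of \<open>F\<close> at \<open>x\<close> avoids \<open>h\<close> and, being convex, lies on one side of it.\<close>

lemma F_star_side:
  assumes "(x, h) \<notin> Graph_star F" "(x, h') \<in> Graph_star F"
  shows "F x < h \<Longrightarrow> h' < h" "h < F x \<Longrightarrow> h < h'"
  using assms by (auto simp: mem_Graph_star closed_segment_eq_real_ivl split: if_splits)

text \<open>Near a crossing the strict inequality \<open>(h' - h) * (x' - x) \<noteq> 0\<close> excludes further points at the height
  \<open>h\<close>, so crossings are isolated level points; \<open>crossing_sides\<close> and \<open>F_star_side\<close> give the converse.\<close>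

lemma isolated_iff_crossing:
  assumes h: "h \<notin> exceptional"
  shows "c \<in> isolated_points (level_set F h) \<longleftrightarrow>
    (c, h) \<in> Graph_star_plus F \<union> Graph_star_minus F"
proof
  assume "c \<in> isolated_points (level_set F h)"
  then obtain d where d: "d > 0" "level_set F h \<inter> {c - d<..<c + d} = {c}"
    by (auto simp: isolated_points_def)
  have cL: "(c, h) \<in> Graph_star F" using d by auto
  have nL: "(x, h) \<notin> Graph_star F" if "c - d < x" "x < c + d" "x \<noteq> c" for x
  proof
    assume "(x, h) \<in> Graph_star F"
    with that have "x \<in> level_set F h \<inter> {c - d<..<c + d}" by simp
    with that show False unfolding d(2) by simp
  qed
  from crossing_sides[OF h d(2,1)]
  show "(c, h) \<in> Graph_star_plus F \<union> Graph_star_minus F"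
  proof
    assume "(\<forall>x. c - d < x \<and> x < c \<longrightarrow> F x < h) \<and> (\<forall>x. c < x \<and> x < c + d \<longrightarrow> h < F x)"
    then have "(h' - h) * (x' - c) > 0"
      if "(x', h') \<in> Graph_star F" "c - d < x'" "x' < c + d" "x' \<noteq> c" for x' h'
      using nL[OF that(2-4)] F_star_side[OF _ that(1)] that(2-4)
      by (auto simp: zero_less_mult_iff neq_iff)
    then have "\<forall>(x', h')\<in>Graph_star F. x' \<in> {c - d<..<c + d} - {c} \<longrightarrow> (h' - h) * (x' - c) > 0"
      by auto
    then have "(c, h) \<in> Graph_star_plus F"
      using cL d(1) unfolding Graph_star_plus_def mem_Collect_eq prod.case
      by (intro conjI exI[of _ "{c - d<..<c + d}"]) auto
    then show ?thesis by simp
  next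
    assume "(\<forall>x. c - d < x \<and> x < c \<longrightarrow> h < F x) \<and> (\<forall>x. c < x \<and> x < c + d \<longrightarrow> F x < h)"
    then have "(h' - h) * (x' - c) < 0"
      if "(x', h') \<in> Graph_star F" "c - d < x'" "x' < c + d" "x' \<noteq> c" for x' h'
      using nL[OF that(2-4)] F_star_side[OF _ that(1)] that(2-4)
      by (auto simp: mult_less_0_iff neq_iff)
    then have "\<forall>(x', h')\<in>Graph_star F. x' \<in> {c - d<..<c + d} - {c} \<longrightarrow> (h' - h) * (x' - c) < 0"
      by auto
    then have "(c, h) \<in> Graph_star_minus F"
      using cL d(1) unfolding Graph_star_minus_def mem_Collect_eq prod.case
      by (intro conjI exI[of _ "{c - d<..<c + d}"]) auto
    then show ?thesis by simp
  qed
next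
  assume *: "(c, h) \<in> Graph_star_plus F \<union> Graph_star_minus F"
  then have cL: "(c, h) \<in> Graph_star F" by (auto simp: Graph_star_plus_def Graph_star_minus_def)
  from * obtain U where U: "open U" "c \<in> U"
     "\<forall>(x', h')\<in>Graph_star F. x' \<in> U - {c} \<longrightarrow> (h' - h) * (x' - c) \<noteq> 0"
    by (fastforce simp: Graph_star_plus_def Graph_star_minus_def)
  obtain d where d: "d > 0" "ball c d \<subseteq> U" using U open_contains_ball by blast
  have "level_set F h \<inter> {c - d<..<c + d} = {c}"
  proof -
    have "x \<in> U" if "x \<in> {c - d<..<c + d}" for x
      using d(2) that by (auto simp: subset_iff dist_real_def)
    then show ?thesis using U(3) d(1) cL by fastforce
  qed
  with d show "c \<in> isolated_points (level_set F h)" by (auto simp: isolated_points_def)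
qed

lemma crossings_disjoint:
  "(c, h) \<notin> Graph_star_plus F \<inter> Graph_star_minus F"
proof
  assume *: "(c, h) \<in> Graph_star_plus F \<inter> Graph_star_minus F"
  obtain U where U: "open U" "c \<in> U"
     "\<forall>(x', h')\<in>Graph_star F. x' \<in> U - {c} \<longrightarrow> (h' - h) * (x' - c) > 0"
    using * by (auto simp: Graph_star_plus_def)
  obtain V where V: "open V" "c \<in> V"
     "\<forall>(x', h')\<in>Graph_star F. x' \<in> V - {c} \<longrightarrow> (h' - h) * (x' - c) < 0"
    using * by (auto simp: Graph_star_minus_def)
  obtain d where d: "d > 0" "ball c d \<subseteq> U \<inter> V"
    using U V open_contains_ball[of "U \<inter> V"] by blast
  have "c + d / 2 \<in> ball c d" using d(1) by (simp add: dist_real_def)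
  with d have "c + d / 2 \<in> U - {c}" "c + d / 2 \<in> V - {c}" by auto
  with U(3) V(3) F_mem_Graph_star[of "c + d / 2"] show False by fastforce
qed

lemma crossing_number_eq:
  assumes h: "h \<notin> exceptional"
  shows "crossing_number F h = ecard (isolated_points (level_set F h))"
proof -
  let ?P = "(UNIV \<times> {h}) \<inter> Graph_star_plus F" and ?M = "(UNIV \<times> {h}) \<inter> Graph_star_minus F"
  have "crossing_number F h = ecard (?P \<union> ?M)"
    unfolding crossing_number_def using crossings_disjoint by (intro plus_emeasure) auto
  also have "?P \<union> ?M = (\<lambda>x. (x, h)) ` isolated_points (level_set F h)"
    using isolated_iff_crossing[OF h] by auto
  also have "ecard \<dots> = ecard (isolated_points (level_set F h))"
    by (rule antisym; rule ecard_le_inj[where f=fst] ecard_le_inj[where f="\<lambda>x. (x, h)"]) (auto intro: inj_onI)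
  finally show ?thesis .
qed

text \<open>The number of isolated level points is measurable, and a function that differs from a measurable one
  only at countably many points is measurable.\<close>

lemma borel_measurable_crossing_number: "crossing_number F \<in> borel_measurable borel"
  by (rule measurable_discrete_difference[OF borel_measurable_ecard_isolated countable_exceptional])
     (auto simp: crossing_number_eq)

end

section \<open>Parity of the rank along a finite level\<close>

lemma nat_initial_segment:
  fixes S :: "nat set"
  assumes "finite S" "\<And>i j. i \<in> S \<Longrightarrow> j < i \<Longrightarrow> j \<in> S"
  shows "S = {..<card S}"
proof (cases "S = {}")
  case False
  have "S = {..Max S}"
    using assms Max_ge[OF assms(1)] Max_in[OF assms(1) False] by (auto simp: le_less)
  then show ?thesis by (metis card_atMost lessThan_Suc_atMost)
qed simp

text \<open>The indices of the elements in a down-closed set form an initial segment, whose length is the number of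
  these elements.\<close>

lemma nth_sorted_list_of_set_mem_iff:
  fixes L D :: "real set"
  assumes fin: "finite L" and D: "\<And>a b. b \<in> D \<Longrightarrow> a \<le> b \<Longrightarrow> a \<in> D"
    and i: "i < length (sorted_list_of_set L)"
  shows "sorted_list_of_set L ! i \<in> D \<longleftrightarrow> i < card (L \<inter> D)"
proof -
  let ?xs = "sorted_list_of_set L"
  let ?S = "{i. i < length ?xs \<and> ?xs ! i \<in> D}"
  have "?S = {..<card ?S}"
  proof (rule nat_initial_segment)
    fix i j assume "i \<in> ?S" "j < i"
    then show "j \<in> ?S"
      using D sorted_nth_mono[OF sorted_sorted_list_of_set, of j i L] by auto
  qed simp
  moreover have "card ?S = card (L \<inter> D)"
  proof (rule bij_betw_same_card)
    show "bij_betw (\<lambda>i. ?xs ! i) ?S (L \<inter> D)"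
      unfolding bij_betw_def
    proof
      show "inj_on ((!) ?xs) ?S" by (auto intro!: inj_onI simp: nth_eq_iff_index_eq)
      have "(!) ?xs ` ?S = {?xs ! i |i. i < length ?xs} \<inter> D" by blast
      also have "\<dots> = L \<inter> D"
        by (simp only: set_conv_nth[symmetric] set_sorted_list_of_set[OF fin])
      finally show "(!) ?xs ` ?S = L \<inter> D" .
    qed
  qed
  ultimately show ?thesis using i by auto
qed

lemma card_even_below: "card {i::nat. 2 * i < r} = (r + 1) div 2"
proof -
  have "{i::nat. 2 * i < r} = {..<(r + 1) div 2}" by auto
  then show ?thesis by simp
qed

lemma card_odd_below: "card {i::nat. 2 * i + 1 < r} = r div 2"
proof -
  have "{i::nat. 2 * i + 1 < r} = {..<r div 2}" by auto
  then show ?thesis by simp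
qed

lemma finite_set_isolated:
  fixes L :: "real set"
  assumes "finite L" "c \<in> L"
  shows "\<exists>d>0. L \<inter> {c - d<..<c + d} = {c}"
proof -
  obtain d where d: "d > 0" "\<forall>x\<in>L. x \<noteq> c \<longrightarrow> d \<le> dist c x"
    using finite_set_avoid[OF assms(1), of c] by auto
  have "x = c" if "x \<in> L \<inter> {c - d<..<c + d}" for x
    using d that by (force simp: dist_real_def)
  with d(1) assms(2) show ?thesis by (intro exI[of _ d]) auto
qed

context cadlag_excursion
begin

text \<open>Induction on the number of level points up to \<open>x\<close>. Without any, the sign of \<open>F - h\<close> is constant up to \<open>x\<close>
  and is the one at minus infinity, where \<open>F\<close> vanishes. The last level point \<open>c\<close> up to \<open>x\<close> is a crossing: it
  changes both the parity and the side, and no level point separates it from \<open>x\<close>.\<close>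

lemma odd_rank_iff_off_level:
  assumes h: "h \<notin> exceptional" and fin: "finite (level_set F h)" and x: "x \<notin> level_set F h"
  shows "odd (card (level_set F h \<inter> {..x})) \<longleftrightarrow> (if 0 < h then h < F x else F x < h)"
  using x
proof (induction "card (level_set F h \<inter> {..x})" arbitrary: x)
  case 0
  have h0: "h \<noteq> 0" using h by (auto simp: exceptional_def)
  have ne: "F x \<noteq> h" using 0 F_mem_Graph_star[of x] by auto
  have "eventually (\<lambda>y. \<bar>F y\<bar> < \<bar>h\<bar> \<and> y \<le> x) at_bot"
    using tendstoD[OF lim_bot, of "\<bar>h\<bar>"] h0 eventually_le_at_bot[of x] by (auto simp: eventually_conj_iff)
  then obtain y where y: "\<bar>F y\<bar> < \<bar>h\<bar>" "y \<le> x" by (auto simp: eventually_at_bot_linorder)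
  have "level_set F h \<inter> {..x} = {}" using 0 fin by simp
  then have "{y..x} \<inter> level_set F h = {}" by auto
  from side_constant[OF y(2) this] have "\<not> (if 0 < h then h < F x else F x < h)"
    using y(1) h0 ne by auto
  moreover have "even (card (level_set F h \<inter> {..x}))" using 0 by simp
  ultimately show ?case by blast
next
  case (Suc n)
  let ?L = "level_set F h"
  have ne: "?L \<inter> {..x} \<noteq> {}" using Suc.hyps(2) by force
  have finx: "finite (?L \<inter> {..x})" using fin by simp
  define c where "c = Max (?L \<inter> {..x})"
  have c: "c \<in> ?L" "c \<le> x" using Max_in[OF finx ne] by (auto simp: c_def)
  then have "c < x" using Suc.prems by (cases "c = x") auto
  have le_c: "y \<le> c" if "y \<in> ?L" "y \<le> x" for y using Max_ge[OF finx] that by (auto simp: c_def)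
  obtain d where d: "d > 0" "?L \<inter> {c - d<..<c + d} = {c}" using finite_set_isolated[OF fin c(1)] by blast
  have near: "y \<notin> ?L" if "c - d < y" "y < c + d" "y \<noteq> c" for y
  proof
    assume "y \<in> ?L"
    with that have "y \<in> ?L \<inter> {c - d<..<c + d}" by simp
    with that show False unfolding d(2) by simp
  qed
  \<comment> \<open>One point on either side of \<open>c\<close>, both closer to \<open>c\<close> than any other level point.\<close>
  define z where "z = c - d / 2"
  define w where "w = min (c + d / 2) x"
  have z: "c - d < z" "z < c" and w: "c < w" "w < c + d" "w \<le> x"
    using d(1) \<open>c < x\<close> by (auto simp: z_def w_def)
  have zL: "z \<notin> ?L" using near[of z] z d(1) by auto
  have wL: "w \<notin> ?L" using near[of w] w d(1) by auto
  have "?L \<inter> {..x} = insert c (?L \<inter> {..z})"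
  proof (intro set_eqI iffI)
    fix y assume y: "y \<in> ?L \<inter> {..x}"
    then have "y \<le> c" using le_c by auto
    with near[of y] y z d(1) show "y \<in> insert c (?L \<inter> {..z})" by (cases "y \<le> z") auto
  qed (use c z in auto)
  then have card: "card (?L \<inter> {..x}) = Suc (card (?L \<inter> {..z}))"
    using z fin by simp
  with Suc.hyps(2) have "n = card (?L \<inter> {..z})" by simp
  from Suc.hyps(1)[OF this zL]
  have IH: "odd (card (?L \<inter> {..z})) \<longleftrightarrow> (if 0 < h then h < F z else F z < h)" .
  have "{w..x} \<inter> ?L = {}"
    using le_c w(1) by force
  from side_constant[OF w(3) this] have wx: "F w < h \<longleftrightarrow> F x < h" .
  have "F x \<noteq> h" "F w \<noteq> h" "F z \<noteq> h"
    using Suc.prems wL zL F_mem_Graph_star[of x] F_mem_Graph_star[of w] F_mem_Graph_star[of z] by auto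
  moreover have "F z < h \<longleftrightarrow> h < F w"
    using crossing_sides[OF h d(2,1)] z w by force
  ultimately show ?case
    unfolding card even_Suc IH using wx by auto
qed

text \<open>A level point \<open>x\<close> with \<open>F x \<noteq> h\<close> is a jump, and a point slightly to the right of it has the same rank and
  the same side. Only the single height \<open>F x\<close> has to be excluded, whereas \<open>x\<close> may lie on the level for an
  interval of heights.\<close>

lemma odd_rank_iff:
  assumes h: "h \<notin> exceptional" and fin: "finite (level_set F h)" and x: "F x \<noteq> h"
  shows "odd (card (level_set F h \<inter> {..x})) \<longleftrightarrow> (if 0 < h then h < F x else F x < h)"
proof (cases "x \<in> level_set F h")
  case False
  then show ?thesis using odd_rank_iff_off_level[OF h fin] by simp
next
  case True
  let ?L = "level_set F h"
  obtain d where d: "d > 0" "?L \<inter> {x - d<..<x + d} = {x}" using finite_set_isolated[OF fin True] by blast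
  have "x < x + d" using d(1) by simp
  have "\<exists>v>x. v < x + d \<and> (F v < h \<longleftrightarrow> F x < h) \<and> (h < F v \<longleftrightarrow> h < F x)"
  proof (cases "F x < h")
    case True
    then obtain v where "x < v" "v < x + d" "\<forall>w\<in>{x..v}. F w \<in> {..<h}"
      using right_neighbourhood[of "{..<h}" x "x + d"] \<open>x < x + d\<close> by auto
    then have "F v < h" by simp
    with True \<open>x < v\<close> \<open>v < x + d\<close> show ?thesis by (intro exI[of _ v]) auto
  next
    case False
    with x obtain v where "x < v" "v < x + d" "\<forall>w\<in>{x..v}. F w \<in> {h<..}"
      using right_neighbourhood[of "{h<..}" x "x + d"] \<open>x < x + d\<close> by auto
    then have "h < F v" by simp
    with False x \<open>x < v\<close> \<open>v < x + d\<close> show ?thesis by (intro exI[of _ v]) auto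
  qed
  then obtain v where v: "x < v" "v < x + d" "F v < h \<longleftrightarrow> F x < h" "h < F v \<longleftrightarrow> h < F x" by blast
  have near: "y \<notin> ?L" if "x < y" "y < x + d" for y
  proof
    assume "y \<in> ?L"
    with that d(1) have "y \<in> ?L \<inter> {x - d<..<x + d}" by simp
    with that show False unfolding d(2) by simp
  qed
  have "y \<le> x \<longleftrightarrow> y \<le> v" if "y \<in> ?L" for y
    using v(1,2) near[of y] that by (cases "y \<le> x") auto
  then have "?L \<inter> {..x} = ?L \<inter> {..v}" by blast
  moreover have "v \<notin> ?L" using near v by auto
  ultimately show ?thesis using odd_rank_iff_off_level[OF h fin, of v] v by simp
qed

text \<open>To the right of all level points \<open>F\<close> is close to its limit \<open>0\<close>, hence not beyond \<open>h\<close>.\<close>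

lemma even_card_level_set:
  assumes h: "h \<notin> exceptional" and fin: "finite (level_set F h)"
  shows "even (card (level_set F h))"
proof -
  let ?L = "level_set F h"
  have h0: "h \<noteq> 0" using h by (auto simp: exceptional_def)
  have "eventually (\<lambda>y. \<bar>F y\<bar> < \<bar>h\<bar> \<and> Max (insert 0 ?L) \<le> y) at_top"
    using tendstoD[OF lim_top, of "\<bar>h\<bar>"] h0 eventually_ge_at_top by (auto simp: eventually_conj_iff)
  then obtain y where y: "\<bar>F y\<bar> < \<bar>h\<bar>" "Max (insert 0 ?L) \<le> y" by (auto simp: eventually_at_top_linorder)
  have "?L \<inter> {..y} = ?L"
    using y(2) fin by auto
  moreover have "F y \<noteq> h" "\<not> (if 0 < h then h < F y else F y < h)" using y(1) by auto
  ultimately show ?thesis using odd_rank_iff[OF h fin, of y] by simp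
qed

end

section \<open>The kernel of excursion pairs\<close>

definition level_points :: "(real \<Rightarrow> real) \<Rightarrow> real \<Rightarrow> real list" where
  "level_points F h = sorted_list_of_set (level_set F h)"

text \<open>Beyond half of the length of \<open>level_points F h\<close> the list accesses are meaningless, and the index has to be
  bounded wherever the pair is used.\<close>

definition excursion_pair :: "(real \<Rightarrow> real) \<Rightarrow> real \<Rightarrow> nat \<Rightarrow> real \<times> real" where
  "excursion_pair F h i =
     (if 0 < h then (level_points F h ! (2 * i), level_points F h ! (2 * i + 1))
      else (level_points F h ! (2 * i + 1), level_points F h ! (2 * i)))"

lemma excursion_pairs_eq:
  "excursion_pairs F h =
     (if h = 0 then {} else excursion_pair F h ` {i. 2 * i + 1 < length (level_points F h)})"
  unfolding excursion_pairs_def excursion_pair_def level_points_def Let_def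
  by (cases "0 < h"; cases "h = 0") (simp_all add: setcompr_eq_image)

lemma inj_excursion_pair:
  "inj_on (excursion_pair F h) {i. 2 * i + 1 < length (level_points F h)}"
proof (rule inj_onI)
  fix i j assume ij: "i \<in> {i. 2 * i + 1 < length (level_points F h)}"
    "j \<in> {i. 2 * i + 1 < length (level_points F h)}" "excursion_pair F h i = excursion_pair F h j"
  then have "level_points F h ! (2 * i) = level_points F h ! (2 * j)"
    by (auto simp: excursion_pair_def split: if_splits)
  moreover have "distinct (level_points F h)" by (simp add: level_points_def)
  ultimately have "2 * i = 2 * j" using ij by (subst (asm) nth_eq_iff_index_eq) auto
  then show "i = j" by simp
qed

lemma finite_pair_indices: "finite {i. 2 * i + 1 < (n::nat)}"
  by (rule finite_subset[of _ "{..n}"]) auto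

text \<open>Numerator and denominator are written as cardinalities of index sets rather than of sets of pairs, since
  the former are countable combinations of measurable events.\<close>

lemma emeasure_excursion_kernel:
  assumes C: "C \<in> sets borel"
  shows "emeasure (excursion_kernel F h) C =
    (if h = 0 \<or> \<not> 1 < length (level_points F h) then indicator C (0, 0)
     else ecard {i. 2 * i + 1 < length (level_points F h) \<and> excursion_pair F h i \<in> C}
        / ecard {i. 2 * i + 1 < length (level_points F h)})"
proof -
  let ?I = "{i. 2 * i + 1 < length (level_points F h)}"
  let ?E = "excursion_pairs F h"
  have ne: "?I \<noteq> {} \<longleftrightarrow> 1 < length (level_points F h)"
    by (auto intro!: exI[of _ 0])
  show ?thesis
  proof (cases "?E = {}")
    case True
    with ne have "h = 0 \<or> \<not> 1 < length (level_points F h)"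
      by (auto simp: excursion_pairs_eq split: if_splits)
    with True C show ?thesis by (simp add: excursion_kernel_def)
  next
    case False
    with ne have h: "h \<noteq> 0" "1 < length (level_points F h)"
      by (auto simp: excursion_pairs_eq split: if_splits)
    have E: "?E = excursion_pair F h ` ?I" using h by (simp add: excursion_pairs_eq)
    have fin: "finite ?E" unfolding E by (intro finite_imageI finite_pair_indices)
    have card_E: "card ?E = card ?I" unfolding E by (rule card_image[OF inj_excursion_pair])
    have "?E \<inter> C = excursion_pair F h ` {i \<in> ?I. excursion_pair F h i \<in> C}" unfolding E by auto
    then have card_EC: "card (?E \<inter> C) = card {i \<in> ?I. excursion_pair F h i \<in> C}"
      using inj_excursion_pair[of F h] by (auto intro!: card_image intro: inj_on_subset)
    have pos: "0 < card ?E" using False fin by (simp add: card_gt_0_iff)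
    have "emeasure (excursion_kernel F h) C = emeasure (measure_pmf (pmf_of_set ?E)) C"
      using False C by (simp add: excursion_kernel_def emeasure_distr)
    also have "\<dots> = ennreal (real (card (?E \<inter> C)) / real (card ?E))"
      by (rule emeasure_pmf_of_set[OF False fin])
    also have "\<dots> = of_nat (card (?E \<inter> C)) / of_nat (card ?E)"
      using pos by (simp add: divide_ennreal[symmetric] ennreal_of_nat_eq_real_of_nat)
    also have "\<dots> = ecard {i \<in> ?I. excursion_pair F h i \<in> C} / ecard ?I"
      unfolding card_E card_EC using finite_pair_indices[of "length (level_points F h)"] by simp
    finally show ?thesis using h by simp
  qed
qed

context cadlag_excursion
begin

lemma length_level_points: "length (level_points F h) = card (level_set F h)"
  by (simp add: level_points_def)

lemma measurable_length_level_points: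
  "Measurable.pred borel (\<lambda>h. n < length (level_points F h))"
proof -
  have [measurable]: "(\<lambda>h. ecard (level_set F h)) \<in> borel_measurable borel"
    using borel_measurable_ecard_level[of UNIV] by auto
  have "n < length (level_points F h) \<longleftrightarrow> ecard (level_set F h) \<noteq> top \<and> of_nat n < ecard (level_set F h)" for h
    by (cases "finite (level_set F h)") (simp_all add: length_level_points)
  then show ?thesis by simp
qed

text \<open>The \<open>i\<close>-th level point is less than \<open>t\<close> iff more than \<open>i\<close> level points are. The value \<open>0\<close> at heights with too
  few level points is arbitrary.\<close>

lemma borel_measurable_level_point:
  "(\<lambda>h. if i < length (level_points F h) then level_points F h ! i else 0) \<in> borel_measurable borel"
  (is "?X \<in> _")
proof (subst borel_measurable_iff_less, intro allI)
  fix t :: real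
  have "\<exists>p' q'. {..<t} \<inter> {p..<q} = {p'..<q'}" for p q :: real
    by (intro exI[of _ p] exI[of _ "min q t"]) auto
  then have [measurable]: "(\<lambda>h. ecard (level_set F h \<inter> {..<t})) \<in> borel_measurable borel"
    by (rule borel_measurable_ecard_level)
  note [measurable] = measurable_length_level_points
  have "?X h < t \<longleftrightarrow>
    (if i < length (level_points F h) then of_nat i < ecard (level_set F h \<inter> {..<t}) else 0 < t)" for h
  proof (cases "i < length (level_points F h)")
    case True
    then have fin: "finite (level_set F h)"
      by (metis card.infinite length_level_points not_less_zero)
    have "level_points F h ! i \<in> {..<t} \<longleftrightarrow> i < card (level_set F h \<inter> {..<t})"
      unfolding level_points_def
      by (rule nth_sorted_list_of_set_mem_iff[OF fin]) (use True in \<open>auto simp: level_points_def\<close>)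
    with True fin show ?thesis by simp
  qed simp
  then have "{h \<in> space borel. ?X h < t} = {h \<in> space borel.
    (if i < length (level_points F h) then of_nat i < ecard (level_set F h \<inter> {..<t}) else 0 < t)}"
    by simp
  also have "\<dots> \<in> sets borel" by measurable
  finally show "{h \<in> space borel. ?X h < t} \<in> sets borel" .
qed

lemma measurable_excursion_kernel: "excursion_kernel F \<in> borel \<rightarrow>\<^sub>M prob_algebra borel"
proof (rule measurable_prob_algebraI)
  show prob: "prob_space (excursion_kernel F h)" for h
  proof (cases "excursion_pairs F h = {}")
    case True
    then show ?thesis by (simp add: excursion_kernel_def prob_space_return)
  next
    case False
    then show ?thesis by (simp add: excursion_kernel_def measure_pmf.prob_space_distr)
  qed
  show "excursion_kernel F \<in> borel \<rightarrow>\<^sub>M subprob_algebra borel"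
  proof (rule measurable_subprob_algebra)
    show "subprob_space (excursion_kernel F h)" for h
      using prob by (rule prob_space_imp_subprob_space)
    show "sets (excursion_kernel F h) = sets borel" for h
      by (simp add: excursion_kernel_def)
    fix C :: "(real \<times> real) set" assume C[measurable]: "C \<in> sets borel"
    let ?X = "\<lambda>i h. if i < length (level_points F h) then level_points F h ! i else 0"
    let ?P = "\<lambda>i h. if 0 < h then (?X (2 * i) h, ?X (2 * i + 1) h) else (?X (2 * i + 1) h, ?X (2 * i) h)"
    note [measurable] = measurable_length_level_points borel_measurable_level_point
    have [measurable]: "?P i \<in> borel_measurable borel" for i
      by (intro measurable_If borel_measurable_Pair borel_measurable_level_point) measurable
    have P: "2 * i + 1 < length (level_points F h) \<and> excursion_pair F h i \<in> C \<longleftrightarrow>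
      2 * i + 1 < length (level_points F h) \<and> ?P i h \<in> C" for i h
      by (auto simp: excursion_pair_def)
    have [measurable]: "(\<lambda>h. ecard {i. 2 * i + 1 < length (level_points F h) \<and> ?P i h \<in> C}) \<in> borel_measurable borel"
      by (rule borel_measurable_ecard) measurable
    have [measurable]: "(\<lambda>h. ecard {i. 2 * i + 1 < length (level_points F h)}) \<in> borel_measurable borel"
      by (rule borel_measurable_ecard) measurable
    show "(\<lambda>h. emeasure (excursion_kernel F h) C) \<in> borel_measurable borel"
      unfolding emeasure_excursion_kernel[OF C] P by measurable
  qed
qed

text \<open>In a finite set every point is isolated, so that all level points are crossings.\<close>

lemma regular_level:
  assumes h: "h \<notin> exceptional" and fin: "finite (level_set F h)"
  shows "level_set F h = isolated_points (level_set F h)"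
    and "crossing_number F h = of_nat (card (level_set F h))"
    and "level_set F h = {x. (x, h) \<in> Graph_star_plus F \<union> Graph_star_minus F}"
proof -
  have "isolated_points (level_set F h) \<subseteq> level_set F h" by (auto simp: isolated_points_def)
  moreover have "level_set F h \<subseteq> isolated_points (level_set F h)"
    using finite_set_isolated[OF fin] unfolding isolated_points_def by blast
  ultimately show *: "level_set F h = isolated_points (level_set F h)" by blast
  show "crossing_number F h = of_nat (card (level_set F h))"
    using crossing_number_eq[OF h] fin unfolding *[symmetric] by simp
  show "level_set F h = {x. (x, h) \<in> Graph_star_plus F \<union> Graph_star_minus F}"
    by (subst *) (use isolated_iff_crossing[OF h] in blast)
qed

text \<open>The weight \<open>N / 2\<close> of a level with \<open>N\<close> points cancels the normalization of the uniform law on its \<open>N / 2\<close>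
  pairs.\<close>

lemma weighted_kernel:
  assumes h: "h \<notin> exceptional" and fin: "finite (level_set F h)" and C: "C \<in> sets borel"
  shows "crossing_number F h / 2 * emeasure (excursion_kernel F h) C =
    of_nat (card {i. 2 * i + 1 < card (level_set F h) \<and> excursion_pair F h i \<in> C})"
proof (cases "card (level_set F h) = 0")
  case True
  then show ?thesis by (simp add: regular_level(2)[OF h fin])
next
  case False
  have h0: "h \<noteq> 0" using h by (auto simp: exceptional_def)
  define n where "n = card (level_set F h) div 2"
  have n: "card (level_set F h) = 2 * n"
    using even_card_level_set[OF h fin] by (simp add: n_def)
  with False have npos: "0 < n" by simp
  have I: "ecard {i. 2 * i + 1 < card (level_set F h)} = of_nat n"
    using card_odd_below[of "2 * n"] finite_pair_indices[of "2 * n"] by (simp add: n)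
  have "finite {i. 2 * i + 1 < card (level_set F h) \<and> excursion_pair F h i \<in> C}" (is "finite ?J")
    by (rule finite_subset[OF _ finite_pair_indices[of "2 * n"]]) (auto simp: n)
  then have J: "ecard ?J = of_nat (card ?J)" by simp
  have half: "(of_nat (2 * n) :: ennreal) / 2 = of_nat n"
  proof -
    have "(of_nat (2 * n) :: ennreal) / 2 = ennreal (2 * real n / 2)"
      by (subst divide_ennreal[symmetric]) (auto simp: ennreal_of_nat_eq_real_of_nat)
    then show ?thesis by (simp add: ennreal_of_nat_eq_real_of_nat)
  qed
  have "crossing_number F h / 2 * emeasure (excursion_kernel F h) C = of_nat n * (of_nat (card ?J) / of_nat n)"
    unfolding emeasure_excursion_kernel[OF C] length_level_points regular_level(2)[OF h fin] I J
    using h0 npos half by (simp add: n)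
  also have "\<dots> = of_nat (card ?J)"
    unfolding ennreal_times_divide mult.commute[of "of_nat n :: ennreal"]
    using npos by (intro mult_divide_eq_ennreal) auto
  finally show ?thesis .
qed

text \<open>If \<open>r\<close> level points lie in \<open>{..x}\<close>, then so do the left endpoints of \<open>(r + 1) div 2\<close> pairs and the right
  endpoints of \<open>r div 2\<close> pairs, because \<open>N\<close> is even. The difference is the parity of \<open>r\<close>, which \<open>odd_rank_iff\<close>
  expresses by the position of \<open>F x\<close>. Below the height \<open>0\<close> the components of the pairs are swapped, and the
  correction moves to the other side.\<close>

lemma excursion_balance:
  assumes h: "h \<notin> exceptional" and fin: "finite (level_set F h)" and x: "F x \<noteq> h"
  shows "card {i. 2 * i + 1 < card (level_set F h) \<and> fst (excursion_pair F h i) \<le> x}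
           + (if F x < h \<and> h < 0 then 1 else 0) =
         card {i. 2 * i + 1 < card (level_set F h) \<and> snd (excursion_pair F h i) \<le> x}
           + (if 0 < h \<and> h < F x then 1 else 0)"
proof -
  let ?L = "level_set F h"
  define r where "r = card (?L \<inter> {..x})"
  have h0: "h \<noteq> 0" using h by (auto simp: exceptional_def)
  have r_le: "r \<le> card ?L" unfolding r_def using fin by (intro card_mono) auto
  have nth: "level_points F h ! i \<le> x \<longleftrightarrow> i < r" if "i < card ?L" for i
    using nth_sorted_list_of_set_mem_iff[OF fin, of "{..x}" i] that
    by (simp add: level_points_def r_def)
  \<comment> \<open>Here evenness matters: \<open>2 * i < r\<close> and \<open>r \<le> N\<close> give \<open>2 * i + 1 < N\<close>.\<close>
  have first: "{i. 2 * i + 1 < card ?L \<and> level_points F h ! (2 * i) \<le> x} = {i. 2 * i < r}"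
    using even_card_level_set[OF h fin] r_le nth by (auto elim!: evenE) presburger
  have second: "{i. 2 * i + 1 < card ?L \<and> level_points F h ! (2 * i + 1) \<le> x} = {i. 2 * i + 1 < r}"
    using r_le nth by auto
  have parity: "(r + 1) div 2 = r div 2 + (if odd r then 1 else 0)" by presburger
  have odd: "odd r \<longleftrightarrow> (if 0 < h then h < F x else F x < h)"
    unfolding r_def by (rule odd_rank_iff[OF h fin x])
  show ?thesis
  proof (cases "0 < h")
    case True
    then have "fst (excursion_pair F h i) = level_points F h ! (2 * i)"
      "snd (excursion_pair F h i) = level_points F h ! (2 * i + 1)" for i
      by (simp_all add: excursion_pair_def)
    with True show ?thesis
      using odd parity by (simp only: first second card_even_below card_odd_below) auto
  next
    case False
    then have "fst (excursion_pair F h i) = level_points F h ! (2 * i + 1)"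
      "snd (excursion_pair F h i) = level_points F h ! (2 * i)" for i
      by (simp_all add: excursion_pair_def)
    with False h0 show ?thesis
      using odd parity by (simp only: first second card_even_below card_odd_below) auto
  qed
qed

end

section \<open>Marginals of the coupling of mutually singular laws\<close>

lemma mutually_singular_sym:
  "mutually_singular \<mu> \<nu> \<Longrightarrow> mutually_singular \<nu> \<mu>"
  unfolding mutually_singular_def
  by (metis Diff_Diff_Int Int_UNIV_left borel_comp Compl_eq_Diff_UNIV)

text \<open>Minimality of the Jordan decomposition: if \<open>\<rho> - \<rho>' = \<mu> - \<nu>\<close> and \<open>\<mu>\<close>, \<open>\<nu>\<close> are mutually singular, then
  \<open>\<mu> \<le> \<rho>\<close>. Indeed \<open>\<mu> = \<rho> - \<rho>' \<le> \<rho>\<close> on a set which carries \<open>\<mu>\<close> and is null for \<open>\<nu>\<close>.\<close>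

lemma mutually_singular_minimal:
  assumes sing: "mutually_singular \<mu> \<nu>"
    and sets: "sets \<mu> = sets borel" "sets \<nu> = sets borel" "sets \<rho> = sets borel"
    and eq: "\<And>B. B \<in> sets borel \<Longrightarrow> emeasure \<rho> B + emeasure \<nu> B = emeasure \<rho>' B + emeasure \<mu> B"
    and B: "B \<in> sets borel"
  shows "emeasure \<mu> B \<le> emeasure \<rho> B"
proof -
  obtain A where A: "A \<in> sets borel" "emeasure \<mu> A = 0" "emeasure \<nu> (UNIV - A) = 0"
    using sing by (auto simp: mutually_singular_def)
  let ?P = "B - A"
  have P: "?P \<in> sets borel" using A B by auto
  have "emeasure \<mu> B \<le> emeasure \<mu> (?P \<union> A)"
    using A B sets by (intro emeasure_mono) auto
  also have "\<dots> \<le> emeasure \<mu> ?P + emeasure \<mu> A"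
    using A P sets by (intro emeasure_subadditive) auto
  also have "\<dots> \<le> emeasure \<rho>' ?P + emeasure \<mu> ?P"
    using A by simp
  also have "\<dots> = emeasure \<rho> ?P + emeasure \<nu> ?P" using eq[OF P] by simp
  also have "emeasure \<nu> ?P = 0"
  proof -
    have "emeasure \<nu> ?P \<le> emeasure \<nu> (UNIV - A)" using A B sets by (intro emeasure_mono) auto
    then show ?thesis using A by simp
  qed
  also have "emeasure \<rho> ?P + 0 \<le> emeasure \<rho> B"
    using B sets by (simp add: emeasure_mono)
  finally show ?thesis .
qed

text \<open>A uniqueness theorem for the signed measures \<open>a - c\<close> and \<open>d - b\<close>; the equation is written with sums to stay
  within positive measures. The sets where it holds form a Dynkin system, and half-lines are stable under
  intersection.\<close>

lemma emeasure_add_eq_from_halflines: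
  fixes a b c d :: "real measure"
  assumes fin: "finite_measure a" "finite_measure b" "finite_measure c" "finite_measure d"
    and sets: "sets a = sets borel" "sets b = sets borel" "sets c = sets borel" "sets d = sets borel"
    and halfline: "\<And>x. measure a {..x} + measure b {..x} = measure c {..x} + measure d {..x}"
    and total: "measure a UNIV + measure b UNIV = measure c UNIV + measure d UNIV"
    and B: "B \<in> sets borel"
  shows "emeasure a B + emeasure b B = emeasure c B + emeasure d B"
proof -
  interpret a: finite_measure a by fact
  interpret b: finite_measure b by fact
  interpret c: finite_measure c by fact
  interpret d: finite_measure d by fact
  have space: "space a = UNIV" "space b = UNIV" "space c = UNIV" "space d = UNIV"
    using sets[THEN sets_eq_imp_space_eq] by auto
  have sigma: "sets borel = sigma_sets UNIV (range (\<lambda>x::real. {..x}))"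
    by (subst borel_eq_atMost) (rule sets_measure_of, simp)
  have stable: "Int_stable (range (\<lambda>x::real. {..x}))" by (auto simp: Int_stable_def)
  have "measure a B + measure b B = measure c B + measure d B"
    using stable subset_UNIV[of "range (\<lambda>x::real. {..x})", folded Pow_UNIV] B[unfolded sigma]
  proof (induction rule: sigma_sets_induct_disjoint)
    case (basic A)
    then show ?case using halfline by auto
  next
    case empty
    then show ?case by simp
  next
    case (compl A)
    then have A: "A \<in> sets borel" by (simp add: sigma)
    show ?case
      using compl total A a.finite_measure_compl[of A] b.finite_measure_compl[of A]
        c.finite_measure_compl[of A] d.finite_measure_compl[of A]
      by (simp add: space sets)
  next
    case (union A)
    then have A: "range A \<subseteq> sets borel" by (simp add: sigma)
    then have "(\<lambda>i. measure a (A i) + measure b (A i)) sums (measure a (\<Union>i. A i) + measure b (\<Union>i. A i))"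
      "(\<lambda>i. measure c (A i) + measure d (A i)) sums (measure c (\<Union>i. A i) + measure d (\<Union>i. A i))"
      using union(1) by (auto intro!: sums_add a.finite_measure_UNION b.finite_measure_UNION
        c.finite_measure_UNION d.finite_measure_UNION simp: sets)
    then show ?case using union(3) by (auto intro: sums_unique2)
  qed
  then show ?thesis
    by (simp add: a.emeasure_eq_measure b.emeasure_eq_measure c.emeasure_eq_measure
      d.emeasure_eq_measure flip: ennreal_plus)
qed

lemma borel_measurable_fst_snd_borel:
  "fst \<in> borel_measurable (borel :: (real \<times> real) measure)"
  "snd \<in> borel_measurable (borel :: (real \<times> real) measure)"
  by (intro borel_measurable_continuous_onI continuous_intros)+

text \<open>Domination on a set and on its complement, with equal totals, leaves no room for a strict inequality.\<close>

lemma prob_measure_eqI_le: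
  assumes "real_distribution P" "real_distribution Q"
    and le: "\<And>B. B \<in> sets borel \<Longrightarrow> emeasure P B \<le> emeasure Q B"
  shows "Q = P"
proof (rule measure_eqI)
  interpret P: real_distribution P by fact
  interpret Q: real_distribution Q by fact
  show "sets Q = sets P" by simp
  fix B assume "B \<in> sets Q"
  then have B: "B \<in> sets borel" by simp
  have "measure P B \<le> measure Q B" "measure P (UNIV - B) \<le> measure Q (UNIV - B)"
    using le[of B] le[of "UNIV - B"] B by (auto simp: P.emeasure_eq_measure Q.emeasure_eq_measure)
  then show "emeasure Q B = emeasure P B"
    using B P.prob_compl[of B] Q.prob_compl[of B] by (simp add: P.emeasure_eq_measure Q.emeasure_eq_measure)
qed

lemma marginals_of_joint_law:
  fixes X Y :: "'a \<Rightarrow> real"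
  assumes [measurable]: "X \<in> borel_measurable M" "Y \<in> borel_measurable M"
    and \<pi>: "distr M borel (\<lambda>\<omega>. (X \<omega>, Y \<omega>)) = \<pi>"
  shows "distr M borel X = distr \<pi> borel fst" "distr M borel Y = distr \<pi> borel snd"
  unfolding \<pi>[symmetric]
  using borel_measurable_fst_snd_borel by (simp_all add: distr_distr comp_def)

locale distribution_pair = M: real_distribution \<mu> + N: real_distribution \<nu> for \<mu> \<nu> :: "real measure"
begin

abbreviation "F \<equiv> diff_cdf \<mu> \<nu>"
abbreviation "Fl \<equiv> (\<lambda>x. measure \<mu> {..<x} - measure \<nu> {..<x})"

lemma diff_cdf_eq: "F = (\<lambda>x. cdf \<mu> x - cdf \<nu> x)"
  by (simp add: diff_cdf_def fun_eq_iff)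

sublocale cadlag_excursion F Fl
proof
  show "(F \<longlongrightarrow> F x) (at_right x)" for x
    using M.cdf_is_right_cont[of x] N.cdf_is_right_cont[of x]
    unfolding continuous_within diff_cdf_eq by (rule tendsto_diff)
  show "(F \<longlongrightarrow> Fl x) (at_left x)" for x
    unfolding diff_cdf_eq by (intro tendsto_diff M.cdf_at_left N.cdf_at_left)
  show "(F \<longlongrightarrow> 0) at_bot"
    unfolding diff_cdf_eq using tendsto_diff[OF M.cdf_lim_at_bot N.cdf_lim_at_bot] by simp
  show "(F \<longlongrightarrow> 0) at_top"
    unfolding diff_cdf_eq using tendsto_diff[OF M.cdf_lim_at_top_prob N.cdf_lim_at_top_prob] by simp
qed

text \<open>Both \<open>F x\<close> and its left limit arise from \<open>Fl p\<close> by adding the \<open>\<mu>\<close>-measure and subtracting the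
  \<open>\<nu>\<close>-measure of a part of the cell, and the segment between them is convex.\<close>

lemma level_between:
  assumes x: "p \<le> x" "x < q" and h: "(x, h) \<in> Graph_star F"
  shows "h \<in> {Fl p - measure \<nu> {p..<q} .. Fl p + measure \<mu> {p..<q}}"
proof -
  have inc: "0 \<le> measure R {..<x} - measure R {..<p} \<and> measure R {..<x} - measure R {..<p} \<le> measure R {p..<q}
      \<and> 0 \<le> measure R {..x} - measure R {..<p} \<and> measure R {..x} - measure R {..<p} \<le> measure R {p..<q}"
    if "real_distribution R" for R
  proof -
    interpret R: real_distribution R by fact
    have 1: "{..<x} = {..<p} \<union> {p..<x}" "{..x} = {..<p} \<union> {p..x}" using x by auto
    have "measure R {..<x} = measure R {..<p} + measure R {p..<x}"
      unfolding 1 by (rule R.finite_measure_Union) auto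
    moreover have "measure R {..x} = measure R {..<p} + measure R {p..x}"
      unfolding 1 by (rule R.finite_measure_Union) auto
    moreover have "measure R {p..<x} \<le> measure R {p..<q}" "measure R {p..x} \<le> measure R {p..<q}"
      using x by (auto intro!: R.finite_measure_mono)
    ultimately show ?thesis by simp
  qed
  have "Fl x \<in> {Fl p - measure \<nu> {p..<q} .. Fl p + measure \<mu> {p..<q}}"
    "F x \<in> {Fl p - measure \<nu> {p..<q} .. Fl p + measure \<mu> {p..<q}}"
    using inc[OF M.real_distribution_axioms] inc[OF N.real_distribution_axioms]
    unfolding diff_cdf_def cdf_def by auto
  then have "closed_segment (Fl x) (F x) \<subseteq> {Fl p - measure \<nu> {p..<q} .. Fl p + measure \<mu> {p..<q}}"
    by (auto simp: closed_segment_eq_real_ivl)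
  with h show ?thesis unfolding mem_Graph_star by blast
qed

lemma emeasure_level_set_meets:
  "emeasure lborel {h. level_set F h \<inter> {p..<q} \<noteq> {}} \<le> emeasure \<mu> {p..<q} + emeasure \<nu> {p..<q}"
proof -
  have "emeasure lborel {h. level_set F h \<inter> {p..<q} \<noteq> {}} \<le>
    emeasure lborel {Fl p - measure \<nu> {p..<q} .. Fl p + measure \<mu> {p..<q}}"
  proof (rule emeasure_mono)
    show "{h. level_set F h \<inter> {p..<q} \<noteq> {}} \<subseteq> {Fl p - measure \<nu> {p..<q} .. Fl p + measure \<mu> {p..<q}}"
    proof
      fix h assume "h \<in> {h. level_set F h \<inter> {p..<q} \<noteq> {}}"
      then obtain x where "p \<le> x" "x < q" "(x, h) \<in> Graph_star F" by auto
      then show "h \<in> {Fl p - measure \<nu> {p..<q} .. Fl p + measure \<mu> {p..<q}}" by (rule level_between)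
    qed
  qed simp
  also have "\<dots> = ennreal (measure \<mu> {p..<q} + measure \<nu> {p..<q})"
    by (subst emeasure_lborel_Icc) (auto simp: algebra_simps)
  also have "\<dots> = emeasure \<mu> {p..<q} + emeasure \<nu> {p..<q}"
    by (simp add: M.emeasure_eq_measure N.emeasure_eq_measure)
  finally show ?thesis .
qed

text \<open>For each generation of cells the bound follows from \<open>emeasure_level_set_meets\<close>, since the cells are
  disjoint; the numbers of cells that are met increase to the number of level points.\<close>

lemma nn_integral_ecard_level_set: "(\<integral>\<^sup>+h. ecard (level_set F h) \<partial>lborel) \<le> 2"
proof -
  let ?I = "\<lambda>k i. {real_of_int i / 2 ^ k ..< (real_of_int i + 1) / 2 ^ k}"
  have hit: "i \<in> dyadic_index k ` level_set F h \<longleftrightarrow> level_set F h \<inter> ?I k i \<noteq> {}" for i k h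
    by (auto simp: image_iff eq_commute[of i] dyadic_index_eq_iff)
  have "Measurable.pred borel (\<lambda>h. level_set F h \<inter> ?I k i \<noteq> {})" for k i
    using sets_level_set_meets by (simp add: pred_def)
  then have meas: "Measurable.pred borel (\<lambda>h. i \<in> dyadic_index k ` level_set F h)" for k i
    unfolding hit .
  have bound: "(\<integral>\<^sup>+h. ecard (dyadic_index k ` level_set F h) \<partial>lborel) \<le> 2" for k
  proof -
    have "(\<integral>\<^sup>+h. ecard {i. i \<in> dyadic_index k ` level_set F h} \<partial>lborel)
        \<le> emeasure \<mu> (space \<mu>) + emeasure \<nu> (space \<nu>)"
    proof (rule nn_integral_ecard_le[where I="?I k"])
      show "Measurable.pred lborel (\<lambda>h. i \<in> dyadic_index k ` level_set F h)" for i
        using meas by simp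
      show "emeasure lborel {h \<in> space lborel. i \<in> dyadic_index k ` level_set F h}
          \<le> emeasure \<mu> (?I k i) + emeasure \<nu> (?I k i)" for i
        unfolding hit using emeasure_level_set_meets by simp
      show "disjoint_family (?I k)"
        unfolding disjoint_family_on_def
      proof (intro ballI impI equals0I)
        fix m n x assume "m \<noteq> n" "x \<in> ?I k m \<inter> ?I k n"
        then show False unfolding Int_iff dyadic_index_eq_iff[symmetric] by simp
      qed
    qed auto
    then show ?thesis using M.emeasure_space_1 N.emeasure_space_1 by simp
  qed
  have "(\<integral>\<^sup>+h. ecard (level_set F h) \<partial>lborel) = (\<integral>\<^sup>+h. (SUP k. ecard (dyadic_index k ` level_set F h)) \<partial>lborel)"
    by (subst ecard_eq_SUP_dyadic) simp
  also have "\<dots> = (SUP k. \<integral>\<^sup>+h. ecard (dyadic_index k ` level_set F h) \<partial>lborel)"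
  proof (rule nn_integral_monotone_convergence_SUP)
    show "incseq (\<lambda>k h. ecard (dyadic_index k ` level_set F h))"
      using incseq_ecard_dyadic by (auto simp: incseq_def le_fun_def)
    show "(\<lambda>h. ecard (dyadic_index k ` level_set F h)) \<in> borel_measurable lborel" for k
      using borel_measurable_ecard[where Q="\<lambda>h i. i \<in> dyadic_index k ` level_set F h", OF meas] by simp
  qed
  also have "\<dots> \<le> 2" using bound by (rule SUP_least)
  finally show ?thesis .
qed

lemma AE_regular: "AE h in lborel. h \<notin> exceptional \<and> finite (level_set F h)"
proof -
  have "AE h in lborel. h \<notin> exceptional"
    using countable_exceptional by (intro AE_not_in countable_imp_null_set_lborel)
  moreover have "AE h in lborel. ecard (level_set F h) \<noteq> \<infinity>"
  proof (rule nn_integral_PInf_AE)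
    show "(\<lambda>h. ecard (level_set F h)) \<in> borel_measurable lborel"
      using borel_measurable_ecard_level[of UNIV] by auto
    show "(\<integral>\<^sup>+h. ecard (level_set F h) \<partial>lborel) \<noteq> \<infinity>"
      using nn_integral_ecard_level_set by (auto simp: top_unique)
  qed
  ultimately show ?thesis
    by eventually_elim (auto simp: emeasure_count_space split: if_splits)
qed

text \<open>With the factor inside the density, integrals against the law of the height combine directly with
  \<open>weighted_kernel\<close>.\<close>

lemma level_law_eq: "level_law \<mu> \<nu> = density lborel (\<lambda>h. crossing_number F h / 2)"
proof (rule measure_eqI)
  fix A assume "A \<in> sets (level_law \<mu> \<nu>)"
  then have A[measurable]: "A \<in> sets borel" by (simp add: level_law_def)
  note [measurable] = borel_measurable_crossing_number
  have "emeasure (level_law \<mu> \<nu>) A = 1 / 2 * (\<integral>\<^sup>+h. crossing_number F h * indicator A h \<partial>lborel)"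
    by (simp add: level_law_def emeasure_density)
  also have "\<dots> = (\<integral>\<^sup>+h. 1 / 2 * (crossing_number F h * indicator A h) \<partial>lborel)"
    by (rule nn_integral_cmult[symmetric]) measurable
  also have "\<dots> = emeasure (density lborel (\<lambda>h. crossing_number F h / 2)) A"
    by (simp add: emeasure_density divide_ennreal_def ac_simps)
  finally show "emeasure (level_law \<mu> \<nu>) A = emeasure (density lborel (\<lambda>h. crossing_number F h / 2)) A" .
qed (simp add: level_law_def)

lemma sets_level_law: "sets (level_law \<mu> \<nu>) = sets borel" and space_level_law: "space (level_law \<mu> \<nu>) = UNIV"
  by (simp_all add: level_law_eq)

text \<open>Only an upper bound: equality holds when \<open>\<mu>\<close> and \<open>\<nu>\<close> are mutually singular, and is obtained from the
  marginals of the coupling in \<open>emeasure_level_law_UNIV\<close>.\<close>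

lemma emeasure_level_law_le: "emeasure (level_law \<mu> \<nu>) UNIV \<le> 1"
proof -
  have [measurable]: "crossing_number F \<in> borel_measurable borel" by (rule borel_measurable_crossing_number)
  have "emeasure (level_law \<mu> \<nu>) UNIV = 1 / 2 * (\<integral>\<^sup>+h. crossing_number F h \<partial>lborel)"
    by (simp add: level_law_def emeasure_density)
  also have "(\<integral>\<^sup>+h. crossing_number F h \<partial>lborel) = (\<integral>\<^sup>+h. ecard (level_set F h) \<partial>lborel)"
    using AE_regular by (intro nn_integral_cong_AE, eventually_elim) (simp add: regular_level(2))
  also have "1 / 2 * \<dots> \<le> 1 / 2 * 2"
    by (intro mult_left_mono nn_integral_ecard_level_set) simp
  also have "\<dots> = 1"
    by (simp add: ennreal_times_divide mult.commute)
  finally show ?thesis .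
qed

abbreviation "coupling \<equiv> singular_excursion_coupling \<mu> \<nu>"

lemma sets_coupling: "sets coupling = sets borel"
  unfolding singular_excursion_coupling_def
  by (rule sets_bind) (auto simp: space_level_law excursion_kernel_def)

lemma space_coupling: "space coupling = UNIV"
  using sets_eq_imp_space_eq[OF sets_coupling] by simp

lemma emeasure_coupling_level_law:
  assumes C: "C \<in> sets borel"
  shows "emeasure coupling C = (\<integral>\<^sup>+h. emeasure (excursion_kernel F h) C \<partial>level_law \<mu> \<nu>)"
  unfolding singular_excursion_coupling_def
proof (rule emeasure_bind[OF _ _ C])
  show "excursion_kernel F \<in> level_law \<mu> \<nu> \<rightarrow>\<^sub>M subprob_algebra borel"
    using measurable_prob_algebraD[OF measurable_excursion_kernel]
    by (simp add: measurable_cong_sets[OF sets_level_law refl])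
qed (simp add: space_level_law)

lemma borel_measurable_emeasure_kernel:
  "C \<in> sets borel \<Longrightarrow> (\<lambda>h. emeasure (excursion_kernel F h) C) \<in> borel_measurable borel"
  using measurable_prob_algebraD[OF measurable_excursion_kernel]
  by (rule measurable_emeasure_kernel)

lemma emeasure_coupling:
  assumes C: "C \<in> sets borel"
  shows "emeasure coupling C = (\<integral>\<^sup>+h. crossing_number F h / 2 * emeasure (excursion_kernel F h) C \<partial>lborel)"
  unfolding emeasure_coupling_level_law[OF C] unfolding level_law_eq
  using borel_measurable_emeasure_kernel[OF C] borel_measurable_crossing_number
  by (subst nn_integral_density) auto

lemma emeasure_coupling_UNIV: "emeasure coupling UNIV = emeasure (level_law \<mu> \<nu>) UNIV"
proof -
  have "emeasure (excursion_kernel F h) UNIV = 1" for h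
    using measurable_space[OF measurable_excursion_kernel, of h]
    by (auto simp: space_prob_algebra dest!: prob_space.emeasure_space_1 sets_eq_imp_space_eq)
  then show ?thesis by (simp add: emeasure_coupling_level_law space_level_law)
qed

lemma finite_measure_coupling: "finite_measure coupling"
proof (rule finite_measureI)
  show "emeasure coupling (space coupling) \<noteq> \<infinity>"
    using emeasure_level_law_le unfolding space_coupling emeasure_coupling_UNIV by (auto simp: top_unique)
qed

lemma measurable_fst_coupling: "fst \<in> coupling \<rightarrow>\<^sub>M borel" and measurable_snd_coupling: "snd \<in> coupling \<rightarrow>\<^sub>M borel"
  by (simp_all add: measurable_cong_sets[OF sets_coupling refl] borel_measurable_fst_snd_borel)

text \<open>The integral of \<open>excursion_balance\<close> over all heights. The heights between \<open>0\<close> and \<open>F x\<close> have Lebesgue measure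
  \<open>\<bar>F x\<bar>\<close>.\<close>

lemma marginal_halfline:
  "emeasure (distr coupling borel fst) {..x} + emeasure lborel {F x<..<0} =
   emeasure (distr coupling borel snd) {..x} + emeasure lborel {0<..<F x}"
proof -
  let ?A = "\<lambda>f h. crossing_number F h / 2 * emeasure (excursion_kernel F h) (f -` {..x})"
  have f: "f -` {..x} \<in> sets borel" if "f \<in> borel_measurable borel" for f :: "real \<times> real \<Rightarrow> real"
    using measurable_sets[OF that, of "{..x}"] by simp
  have fst: "(fst :: real \<times> real \<Rightarrow> real) -` {..x} \<in> sets borel"
    by (rule f[OF borel_measurable_fst_snd_borel(1)])
  have snd: "(snd :: real \<times> real \<Rightarrow> real) -` {..x} \<in> sets borel"
    by (rule f[OF borel_measurable_fst_snd_borel(2)])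
  have [measurable]: "?A fst \<in> borel_measurable borel" "?A snd \<in> borel_measurable borel"
    using borel_measurable_emeasure_kernel fst snd borel_measurable_crossing_number by auto
  have ev: "AE h in lborel. ?A fst h + indicator {F x<..<0} h = ?A snd h + indicator {0<..<F x} h"
  proof -
    have "AE h in lborel. h \<noteq> F x" by (rule AE_lborel_singleton)
    with AE_regular show ?thesis
    proof eventually_elim
      case (elim h)
      have fin: "finite {i. 2 * i + 1 < card (level_set F h) \<and> Q i}" for Q
        by (rule finite_subset[OF _ finite_pair_indices[of "card (level_set F h)"]]) auto
      have "?A fst h + indicator {F x<..<0} h =
        of_nat (card {i. 2 * i + 1 < card (level_set F h) \<and> fst (excursion_pair F h i) \<le> x}
           + (if F x < h \<and> h < 0 then 1 else 0))"
        using elim fst by (simp add: weighted_kernel indicator_def)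
      also have "\<dots> = of_nat (card {i. 2 * i + 1 < card (level_set F h) \<and> snd (excursion_pair F h i) \<le> x}
           + (if 0 < h \<and> h < F x then 1 else 0))"
        using elim excursion_balance[of h x] by simp
      also have "\<dots> = ?A snd h + indicator {0<..<F x} h"
        using elim snd by (simp add: weighted_kernel indicator_def)
      finally show ?case .
    qed
  qed
  have "emeasure (distr coupling borel fst) {..x} + emeasure lborel {F x<..<0} =
     (\<integral>\<^sup>+h. ?A fst h \<partial>lborel) + (\<integral>\<^sup>+h. indicator {F x<..<0} h \<partial>lborel)"
    by (simp add: emeasure_distr[OF measurable_fst_coupling] space_coupling emeasure_coupling[OF fst])
  also have "\<dots> = (\<integral>\<^sup>+h. ?A fst h + indicator {F x<..<0} h \<partial>lborel)"
    by (rule nn_integral_add[symmetric]) auto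
  also have "\<dots> = (\<integral>\<^sup>+h. ?A snd h + indicator {0<..<F x} h \<partial>lborel)"
    by (rule nn_integral_cong_AE) fact
  also have "\<dots> = (\<integral>\<^sup>+h. ?A snd h \<partial>lborel) + (\<integral>\<^sup>+h. indicator {0<..<F x} h \<partial>lborel)"
    by (rule nn_integral_add) auto
  also have "\<dots> = emeasure (distr coupling borel snd) {..x} + emeasure lborel {0<..<F x}"
    by (simp add: emeasure_distr[OF measurable_snd_coupling] space_coupling emeasure_coupling[OF snd])
  finally show ?thesis .
qed

lemma marginals_add:
  assumes B: "B \<in> sets borel"
  shows "emeasure (distr coupling borel fst) B + emeasure \<nu> B = emeasure (distr coupling borel snd) B + emeasure \<mu> B"
proof (rule emeasure_add_eq_from_halflines[OF _ N.finite_measure_axioms _ M.finite_measure_axioms _ _ _ _ _ _ B])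
  interpret coupling: finite_measure coupling by (rule finite_measure_coupling)
  interpret K1: finite_measure "distr coupling borel fst" by (rule coupling.finite_measure_distr[OF measurable_fst_coupling])
  interpret K2: finite_measure "distr coupling borel snd" by (rule coupling.finite_measure_distr[OF measurable_snd_coupling])
  show "finite_measure (distr coupling borel fst)" "finite_measure (distr coupling borel snd)" by unfold_locales
  show "measure (distr coupling borel fst) {..x} + measure \<nu> {..x} = measure (distr coupling borel snd) {..x} + measure \<mu> {..x}" for x
  proof -
    have "ennreal (measure (distr coupling borel fst) {..x} + max 0 (- F x)) = ennreal (measure (distr coupling borel snd) {..x} + max 0 (F x))"
    proof -
      have "emeasure lborel {F x<..<0} = ennreal (max 0 (- F x))" "emeasure lborel {0<..<F x} = ennreal (max 0 (F x))"
        by (cases "F x \<le> 0"; simp add: max_def)+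
      then show ?thesis
        using marginal_halfline[of x] by (simp add: K1.emeasure_eq_measure K2.emeasure_eq_measure)
    qed
    then have "measure (distr coupling borel fst) {..x} + max 0 (- F x) = measure (distr coupling borel snd) {..x} + max 0 (F x)"
      by (subst (asm) ennreal_inj) auto
    then show ?thesis by (simp add: diff_cdf_def cdf_def max_def split: if_splits)
  qed
  show "measure (distr coupling borel fst) UNIV + measure \<nu> UNIV = measure (distr coupling borel snd) UNIV + measure \<mu> UNIV"
    using M.prob_space N.prob_space
    by (simp add: measure_distr[OF measurable_fst_coupling] measure_distr[OF measurable_snd_coupling] space_coupling)
qed auto

context
  assumes sing: "mutually_singular \<mu> \<nu>"
begin

lemma le_marginals:
  assumes B: "B \<in> sets borel"
  shows "emeasure \<mu> B \<le> emeasure (distr coupling borel fst) B" "emeasure \<nu> B \<le> emeasure (distr coupling borel snd) B"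
proof -
  show "emeasure \<mu> B \<le> emeasure (distr coupling borel fst) B"
    by (rule mutually_singular_minimal[OF sing _ _ _ _ B, where \<rho>'="distr coupling borel snd"]) (simp_all add: marginals_add)
  show "emeasure \<nu> B \<le> emeasure (distr coupling borel snd) B"
    by (rule mutually_singular_minimal[OF mutually_singular_sym[OF sing] _ _ _ _ B, where \<rho>'="distr coupling borel fst"])
       (simp_all add: marginals_add)
qed

text \<open>The lower bound comes from the marginals, which dominate probability measures and have the total mass of
  the law of the height.\<close>

lemma emeasure_level_law_UNIV: "emeasure (level_law \<mu> \<nu>) UNIV = 1"
proof (rule antisym)
  have "1 = emeasure \<mu> UNIV" using M.emeasure_space_1 by simp
  also have "\<dots> \<le> emeasure (distr coupling borel fst) UNIV" by (rule le_marginals) simp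
  also have "\<dots> = emeasure (level_law \<mu> \<nu>) UNIV"
    by (simp add: emeasure_distr[OF measurable_fst_coupling] space_coupling emeasure_coupling_UNIV)
  finally show "1 \<le> emeasure (level_law \<mu> \<nu>) UNIV" .
qed (rule emeasure_level_law_le)

lemma prob_space_level_law: "prob_space (level_law \<mu> \<nu>)"
  by (rule prob_spaceI) (simp add: space_level_law emeasure_level_law_UNIV)

lemma prob_space_coupling: "prob_space coupling"
  by (rule prob_spaceI) (simp add: space_coupling emeasure_coupling_UNIV emeasure_level_law_UNIV)

end

lemma marginals_coupling:
  assumes sing: "mutually_singular \<mu> \<nu>"
  shows "distr coupling borel fst = \<mu>" "distr coupling borel snd = \<nu>"
proof -
  interpret coupling: prob_space coupling by (rule prob_space_coupling[OF sing])
  show "distr coupling borel fst = \<mu>"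
    by (intro prob_measure_eqI_le M.real_distribution_axioms le_marginals[OF sing] coupling.real_distribution_distr) (rule measurable_fst_coupling)
  show "distr coupling borel snd = \<nu>"
    by (intro prob_measure_eqI_le N.real_distribution_axioms le_marginals[OF sing] coupling.real_distribution_distr) (rule measurable_snd_coupling)
qed

lemma coupling_in_Marg: "mutually_singular \<mu> \<nu> \<Longrightarrow> coupling \<in> Marg \<mu> \<nu>"
  by (simp add: Marg_def prob_space_coupling sets_coupling marginals_coupling)

lemma AE_level_law_structure:
  "AE h in level_law \<mu> \<nu>. \<exists>N xs. 0 < N \<and> h \<noteq> 0 \<and>
     crossing_number F h = of_nat N \<and> even N \<and>
     (UNIV \<times> {h}) \<inter> Graph_star F =
       (UNIV \<times> {h}) \<inter> (Graph_star_minus F \<union> Graph_star_plus F) \<and>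
     length xs = N \<and> sorted_wrt (<) xs \<and>
     (UNIV \<times> {h}) \<inter> Graph_star F = set xs \<times> {h}"
proof -
  have [measurable]: "(\<lambda>h. crossing_number F h / 2) \<in> borel_measurable lborel"
    using borel_measurable_crossing_number by simp
  show ?thesis
    unfolding level_law_eq
  proof (subst AE_density)
    show "AE h in lborel. 0 < crossing_number F h / 2 \<longrightarrow> (\<exists>N xs. 0 < N \<and> h \<noteq> 0 \<and>
       crossing_number F h = of_nat N \<and> even N \<and>
       (UNIV \<times> {h}) \<inter> Graph_star F =
         (UNIV \<times> {h}) \<inter> (Graph_star_minus F \<union> Graph_star_plus F) \<and>
       length xs = N \<and> sorted_wrt (<) xs \<and>
       (UNIV \<times> {h}) \<inter> Graph_star F = set xs \<times> {h})"
      using AE_regular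
    proof eventually_elim
      case (elim h)
      then have h: "h \<notin> exceptional" and fin: "finite (level_set F h)" by auto
      show ?case
      proof (intro impI exI[of _ "card (level_set F h)"] exI[of _ "sorted_list_of_set (level_set F h)"] conjI)
        assume "0 < crossing_number F h / 2"
        then show "0 < card (level_set F h)" by (auto simp: regular_level(2)[OF h fin] intro!: Nat.gr0I)
        show "h \<noteq> 0" using h by (auto simp: exceptional_def)
        show "(UNIV \<times> {h}) \<inter> Graph_star F =
         (UNIV \<times> {h}) \<inter> (Graph_star_minus F \<union> Graph_star_plus F)"
          using regular_level(3)[OF h fin] by auto
        show "(UNIV \<times> {h}) \<inter> Graph_star F = set (sorted_list_of_set (level_set F h)) \<times> {h}"
          using fin by auto
      qed (use even_card_level_set[OF h fin] in \<open>auto simp: regular_level(2)[OF h fin]\<close>)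
    qed
  qed simp
qed

text \<open>This is the defining property of the conditional law for the whole line as set of heights.\<close>

lemma conditional_law_imp_distr:
  fixes M :: "'a measure"
  assumes "prob_space M" and [measurable]: "H \<in> borel_measurable M" "X \<in> borel_measurable M" "Y \<in> borel_measurable M"
    and H: "distr M borel H = level_law \<mu> \<nu>"
    and cond: "conditional_law M H (\<lambda>\<omega>. (X \<omega>, Y \<omega>)) (excursion_kernel F)"
  shows "distr M borel (\<lambda>\<omega>. (X \<omega>, Y \<omega>)) = coupling"
proof (rule measure_eqI)
  fix C assume "C \<in> sets (distr M borel (\<lambda>\<omega>. (X \<omega>, Y \<omega>)))"
  then have C[measurable]: "C \<in> sets borel" by simp
  have "emeasure (distr M borel (\<lambda>\<omega>. (X \<omega>, Y \<omega>))) C = emeasure M {\<omega> \<in> space M. H \<omega> \<in> UNIV \<and> (X \<omega>, Y \<omega>) \<in> C}"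
    by (subst emeasure_distr) (auto intro!: arg_cong[where f="emeasure M"])
  also have "\<dots> = (\<integral>\<^sup>+h\<in>UNIV. emeasure (excursion_kernel F h) C \<partial>level_law \<mu> \<nu>)"
    using cond[unfolded conditional_law_def H, rule_format, of UNIV C] C by simp
  also have "\<dots> = emeasure coupling C" by (simp add: emeasure_coupling_level_law[OF C])
  finally show "emeasure (distr M borel (\<lambda>\<omega>. (X \<omega>, Y \<omega>))) C = emeasure coupling C" .
qed (simp add: sets_coupling)

end

section \<open>Removing the common part\<close>

lemma finite_measure_if_le:
  assumes "finite_measure \<mu>" "sets \<mu> = sets \<eta>" "emeasure \<eta> (space \<eta>) \<le> emeasure \<mu> (space \<eta>)"
  shows "finite_measure \<eta>"
proof (rule finite_measureI)
  interpret finite_measure \<mu> by fact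
  show "emeasure \<eta> (space \<eta>) \<noteq> \<infinity>"
    using assms(3) emeasure_finite by (auto simp: top_unique)
qed

text \<open>On a Hahn set \<open>Y\<close>, where \<open>\<nu> \<le> \<mu>\<close>, the common part is \<open>\<nu>\<close>; on the complement it is \<open>\<mu>\<close>. The
  differences that remain live on \<open>Y\<close> and on its complement, respectively.\<close>

lemma common_part_decomposition_exists:
  assumes "real_distribution \<mu>" "real_distribution \<nu>"
  shows "\<exists>\<eta> \<mu>\<^sub>0 \<nu>\<^sub>0. common_part_decomposition \<mu> \<nu> \<eta> \<mu>\<^sub>0 \<nu>\<^sub>0"
proof -
  interpret M: real_distribution \<mu> by fact
  interpret N: real_distribution \<nu> by fact
  obtain Y where Y: "Y \<in> sets borel"
    and le: "\<And>X. X \<in> sets borel \<Longrightarrow> X \<subseteq> Y \<Longrightarrow> emeasure \<nu> X \<le> emeasure \<mu> X"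
    and ge: "\<And>X. X \<in> sets borel \<Longrightarrow> X \<inter> Y = {} \<Longrightarrow> emeasure \<mu> X \<le> emeasure \<nu> X"
    using finite_unsigned_Hahn_decomposition[OF M.finite_measure_axioms N.finite_measure_axioms] by auto
  let ?r = "\<lambda>R S. density R (indicator S :: real \<Rightarrow> ennreal)"
  have r: "emeasure (?r R S) A = emeasure R (S \<inter> A)"
    if "S \<in> sets borel" "A \<in> sets borel" "sets R = sets borel" for R :: "real measure" and S A
    using that by (intro emeasure_restricted) auto
  have fin: "finite_measure (?r R S)" if "real_distribution R" "S \<in> sets borel" for R S
  proof -
    interpret R: real_distribution R by fact
    show ?thesis using that(2) by (intro R.finite_measure_restricted) simp
  qed
  define \<mu>\<^sub>0 where "\<mu>\<^sub>0 = diff_measure (?r \<mu> Y) (?r \<nu> Y)"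
  define \<nu>\<^sub>0 where "\<nu>\<^sub>0 = diff_measure (?r \<nu> (UNIV - Y)) (?r \<mu> (UNIV - Y))"
  define \<eta> where "\<eta> = diff_measure \<mu> \<mu>\<^sub>0"
  have em0: "emeasure \<mu>\<^sub>0 A = emeasure \<mu> (Y \<inter> A) - emeasure \<nu> (Y \<inter> A)" if "A \<in> sets borel" for A
    unfolding \<mu>\<^sub>0_def using that Y assms
    by (subst emeasure_diff_measure) (auto simp: r intro!: fin le)
  have en0: "emeasure \<nu>\<^sub>0 A = emeasure \<nu> ((UNIV - Y) \<inter> A) - emeasure \<mu> ((UNIV - Y) \<inter> A)" if "A \<in> sets borel" for A
    unfolding \<nu>\<^sub>0_def using that Y assms
    by (subst emeasure_diff_measure) (auto simp: r intro!: fin ge)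
  have sets: "sets \<mu>\<^sub>0 = sets borel" "sets \<nu>\<^sub>0 = sets borel" by (auto simp: \<mu>\<^sub>0_def \<nu>\<^sub>0_def)
  have m0_le: "emeasure \<mu>\<^sub>0 A \<le> emeasure \<mu> A" if "A \<in> sets borel" for A
  proof -
    have "emeasure \<mu>\<^sub>0 A \<le> emeasure \<mu> (Y \<inter> A)" unfolding em0[OF that] by (rule diff_le_self_ennreal)
    also have "\<dots> \<le> emeasure \<mu> A" using that by (intro emeasure_mono) auto
    finally show ?thesis .
  qed
  have "finite_measure \<mu>\<^sub>0"
    using m0_le sets by (intro finite_measure_if_le[OF M.finite_measure_axioms]) (auto simp: sets_eq_imp_space_eq[OF sets(1)])
  then have eta: "emeasure \<eta> A = emeasure \<mu> A - emeasure \<mu>\<^sub>0 A" if "A \<in> sets borel" for A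
    unfolding \<eta>_def using that m0_le sets by (intro emeasure_diff_measure M.finite_measure_axioms) auto
  have "emeasure \<mu> A = emeasure \<eta> A + emeasure \<mu>\<^sub>0 A" if "A \<in> sets borel" for A
    unfolding eta[OF that] using m0_le[OF that] by (simp add: diff_add_cancel_ennreal)
  moreover have "emeasure \<nu> A = emeasure \<eta> A + emeasure \<nu>\<^sub>0 A" if A: "A \<in> sets borel" for A
  proof -
    let ?a = "measure \<mu> (Y \<inter> A)" and ?b = "measure \<nu> (Y \<inter> A)"
      and ?c = "measure \<mu> ((UNIV - Y) \<inter> A)" and ?d = "measure \<nu> ((UNIV - Y) \<inter> A)"
    have split: "A = (Y \<inter> A) \<union> ((UNIV - Y) \<inter> A)" by auto
    have "measure \<mu> A = ?a + ?c" "measure \<nu> A = ?b + ?d"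
      using A Y by (subst split, subst M.finite_measure_Union N.finite_measure_Union; auto)+
    moreover have "?b \<le> ?a" "?c \<le> ?d"
      using le[of "Y \<inter> A"] ge[of "(UNIV - Y) \<inter> A"] A Y
      by (auto simp: M.emeasure_eq_measure N.emeasure_eq_measure)
    ultimately show ?thesis
      unfolding eta[OF A] em0[OF A] en0[OF A]
      by (simp add: M.emeasure_eq_measure N.emeasure_eq_measure ennreal_minus flip: ennreal_plus)
  qed
  moreover have "mutually_singular \<mu>\<^sub>0 \<nu>\<^sub>0"
    unfolding mutually_singular_def using Y em0[of "UNIV - Y"] en0[of "UNIV - (UNIV - Y)"]
    by (intro bexI[of _ "UNIV - Y"]) auto
  ultimately have "common_part_decomposition \<mu> \<nu> \<eta> \<mu>\<^sub>0 \<nu>\<^sub>0"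
    using sets by (auto simp: common_part_decomposition_def \<eta>_def)
  then show ?thesis by blast
qed

locale common_part = distribution_pair \<mu> \<nu> for \<mu> \<nu> :: "real measure" +
  fixes \<eta> \<mu>\<^sub>0 \<nu>\<^sub>0 :: "real measure"
  assumes decomposition: "common_part_decomposition \<mu> \<nu> \<eta> \<mu>\<^sub>0 \<nu>\<^sub>0"
begin

lemma sets_parts [simp, measurable_cong]: "sets \<eta> = sets borel" "sets \<mu>\<^sub>0 = sets borel" "sets \<nu>\<^sub>0 = sets borel"
  using decomposition by (auto simp: common_part_decomposition_def)

lemma space_parts [simp]: "space \<eta> = UNIV" "space \<mu>\<^sub>0 = UNIV" "space \<nu>\<^sub>0 = UNIV"
  using sets_parts[THEN sets_eq_imp_space_eq] by auto

lemma emeasure_parts: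
  assumes "A \<in> sets borel"
  shows "emeasure \<mu> A = emeasure \<eta> A + emeasure \<mu>\<^sub>0 A" "emeasure \<nu> A = emeasure \<eta> A + emeasure \<nu>\<^sub>0 A"
  using decomposition assms by (auto simp: common_part_decomposition_def)

lemma singular_parts: "mutually_singular \<mu>\<^sub>0 \<nu>\<^sub>0"
  using decomposition by (auto simp: common_part_decomposition_def)

sublocale \<eta>: finite_measure \<eta>
  by (rule finite_measure_if_le[OF M.finite_measure_axioms]) (simp_all add: emeasure_parts)
sublocale \<mu>\<^sub>0: finite_measure \<mu>\<^sub>0
  by (rule finite_measure_if_le[OF M.finite_measure_axioms]) (simp_all add: emeasure_parts)
sublocale \<nu>\<^sub>0: finite_measure \<nu>\<^sub>0
  by (rule finite_measure_if_le[OF N.finite_measure_axioms]) (simp_all add: emeasure_parts)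

lemma measure_parts:
  assumes "A \<in> sets borel"
  shows "measure \<mu> A = measure \<eta> A + measure \<mu>\<^sub>0 A" "measure \<nu> A = measure \<eta> A + measure \<nu>\<^sub>0 A"
  using emeasure_parts[OF assms]
  by (simp_all add: M.emeasure_eq_measure N.emeasure_eq_measure \<eta>.emeasure_eq_measure
    \<mu>\<^sub>0.emeasure_eq_measure \<nu>\<^sub>0.emeasure_eq_measure flip: ennreal_plus)

lemma total_mass:
  "1 - measure \<eta> UNIV = measure \<mu>\<^sub>0 UNIV" "measure \<nu>\<^sub>0 UNIV = measure \<mu>\<^sub>0 UNIV"
  using measure_parts[of UNIV] M.prob_space N.prob_space by auto

lemma emeasure_total_eq: "emeasure \<nu>\<^sub>0 UNIV = emeasure \<mu>\<^sub>0 UNIV"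
  by (simp add: \<mu>\<^sub>0.emeasure_eq_measure \<nu>\<^sub>0.emeasure_eq_measure total_mass)

end

text \<open>The differences \<open>\<mu>\<^sub>0 - \<nu>\<^sub>0\<close> and \<open>\<mu>\<^sub>0' - \<nu>\<^sub>0'\<close> are both \<open>\<mu> - \<nu>\<close>, and the singular pair is minimal. Exchanging
  the two decompositions gives the reverse inequalities, hence uniqueness.\<close>

lemma common_part_decomposition_le:
  assumes dist: "real_distribution \<mu>" "real_distribution \<nu>"
    and d: "common_part_decomposition \<mu> \<nu> \<eta> \<mu>\<^sub>0 \<nu>\<^sub>0"
    and d': "common_part_decomposition \<mu> \<nu> \<eta>' \<mu>\<^sub>0' \<nu>\<^sub>0'"
    and B: "B \<in> sets borel"
  shows "emeasure \<mu>\<^sub>0 B \<le> emeasure \<mu>\<^sub>0' B" "emeasure \<nu>\<^sub>0 B \<le> emeasure \<nu>\<^sub>0' B"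
proof -
  interpret distribution_pair \<mu> \<nu> using dist by (rule distribution_pair.intro)
  interpret D: common_part \<mu> \<nu> \<eta> \<mu>\<^sub>0 \<nu>\<^sub>0 by unfold_locales fact
  interpret D': common_part \<mu> \<nu> \<eta>' \<mu>\<^sub>0' \<nu>\<^sub>0' by unfold_locales fact
  have eq: "emeasure \<mu>\<^sub>0' A + emeasure \<nu>\<^sub>0 A = emeasure \<nu>\<^sub>0' A + emeasure \<mu>\<^sub>0 A" if A: "A \<in> sets borel" for A
    using D.measure_parts[OF A] D'.measure_parts[OF A]
    by (simp add: D.\<mu>\<^sub>0.emeasure_eq_measure D.\<nu>\<^sub>0.emeasure_eq_measure
      D'.\<mu>\<^sub>0.emeasure_eq_measure D'.\<nu>\<^sub>0.emeasure_eq_measure flip: ennreal_plus)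
  show "emeasure \<mu>\<^sub>0 B \<le> emeasure \<mu>\<^sub>0' B"
    by (rule mutually_singular_minimal[OF D.singular_parts _ _ _ eq B]) simp_all
  show "emeasure \<nu>\<^sub>0 B \<le> emeasure \<nu>\<^sub>0' B"
    by (rule mutually_singular_minimal[OF mutually_singular_sym[OF D.singular_parts] _ _ _ eq[symmetric] B]) simp_all
qed

lemma common_part_decomposition_unique:
  assumes dist: "real_distribution \<mu>" "real_distribution \<nu>"
    and d: "common_part_decomposition \<mu> \<nu> \<eta> \<mu>\<^sub>0 \<nu>\<^sub>0"
    and d': "common_part_decomposition \<mu> \<nu> \<eta>' \<mu>\<^sub>0' \<nu>\<^sub>0'"
  shows "\<eta>' = \<eta> \<and> \<mu>\<^sub>0' = \<mu>\<^sub>0 \<and> \<nu>\<^sub>0' = \<nu>\<^sub>0"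
proof -
  interpret distribution_pair \<mu> \<nu> using dist by (rule distribution_pair.intro)
  interpret D: common_part \<mu> \<nu> \<eta> \<mu>\<^sub>0 \<nu>\<^sub>0 by unfold_locales fact
  interpret D': common_part \<mu> \<nu> \<eta>' \<mu>\<^sub>0' \<nu>\<^sub>0' by unfold_locales fact
  have \<mu>\<^sub>0: "\<mu>\<^sub>0' = \<mu>\<^sub>0" 
    using common_part_decomposition_le(1)[OF dist d d'] common_part_decomposition_le(1)[OF dist d' d]
    by (intro measure_eqI antisym) simp_all
  have \<nu>\<^sub>0: "\<nu>\<^sub>0' = \<nu>\<^sub>0" 
    using common_part_decomposition_le(2)[OF dist d d'] common_part_decomposition_le(2)[OF dist d' d]
    by (intro measure_eqI antisym) simp_all
  have "\<eta>' = \<eta>"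
  proof (rule measure_eqI)
    fix A assume "A \<in> sets \<eta>'"
    then have A: "A \<in> sets borel" by simp
    show "emeasure \<eta>' A = emeasure \<eta> A"
      using D.measure_parts(1)[OF A] D'.measure_parts(1)[OF A]
      by (simp add: \<mu>\<^sub>0 D.\<eta>.emeasure_eq_measure D'.\<eta>.emeasure_eq_measure)
  qed simp
  with \<mu>\<^sub>0 \<nu>\<^sub>0 show ?thesis by simp
qed

text \<open>The set function that defines the mixture is countably additive, so that it is the measure it
  generates.\<close>

lemma emeasure_add_scaled:
  fixes P R :: "'b::topological_space measure" and c :: ennreal
  assumes "sets P = sets borel" "sets R = sets borel" and C: "C \<in> sets borel"
  shows "emeasure (measure_of UNIV (sets borel) (\<lambda>C. emeasure P C + c * emeasure R C)) C =
    emeasure P C + c * emeasure R C"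
proof (rule emeasure_measure_of_sigma[OF _ _ _ C])
  show "sigma_algebra UNIV (sets (borel :: 'b measure))"
    using sets.sigma_algebra_axioms[of borel] by simp
  show "countably_additive (sets borel) (\<lambda>C. emeasure P C + c * emeasure R C)"
  proof (rule countably_additiveI)
    fix A :: "nat \<Rightarrow> 'b set" assume A: "range A \<subseteq> sets borel" "disjoint_family A"
    have "(\<Sum>i. emeasure P (A i) + c * emeasure R (A i)) = (\<Sum>i. emeasure P (A i)) + c * (\<Sum>i. emeasure R (A i))"
      by (simp add: suminf_add[symmetric] ennreal_suminf_cmult)
    also have "\<dots> = emeasure P (\<Union>i. A i) + c * emeasure R (\<Union>i. A i)"
      using A assms by (simp add: suminf_emeasure)
    finally show "(\<Sum>i. emeasure P (A i) + c * emeasure R (A i)) = emeasure P (\<Union>i. A i) + c * emeasure R (\<Union>i. A i)" .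
  qed
qed (simp add: positive_def)

lemma emeasure_normalized: "emeasure (normalized \<mu>) A = inverse (emeasure \<mu> UNIV) * emeasure \<mu> A"
  by (simp add: normalized_def)

lemma sets_normalized [simp]: "sets (normalized \<mu>) = sets \<mu>"
  by (simp add: normalized_def)

lemma ennreal_mult_inverse_cancel:
  fixes w a :: ennreal
  assumes "w \<noteq> 0" "w \<noteq> top"
  shows "w * inverse w = 1" "w * (inverse w * a) = a"
proof -
  show 1: "w * inverse w = 1"
    using ennreal_divide_self[of w] assms by (simp add: divide_ennreal_def less_top)
  show "w * (inverse w * a) = a" by (simp add: mult.assoc[symmetric] 1)
qed

lemma real_distribution_normalized:
  assumes "finite_measure \<mu>" "sets \<mu> = sets borel" "emeasure \<mu> UNIV \<noteq> 0"
  shows "real_distribution (normalized \<mu>)"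
proof -
  interpret finite_measure \<mu> by fact
  have space: "space (normalized \<mu>) = UNIV"
    using assms(2) sets_eq_imp_space_eq[of "normalized \<mu>" borel] by simp
  have "emeasure (normalized \<mu>) UNIV = 1"
    unfolding emeasure_normalized using assms(3) emeasure_finite[of UNIV]
    by (subst mult.commute) (rule ennreal_mult_inverse_cancel(1))
  then have "prob_space (normalized \<mu>)" by (intro prob_spaceI) (simp add: space)
  then show ?thesis
    using assms(2) by (simp add: real_distribution_def real_distribution_axioms_def)
qed

lemma mutually_singular_normalized:
  "mutually_singular \<mu> \<nu> \<Longrightarrow> mutually_singular (normalized \<mu>) (normalized \<nu>)"
  by (auto simp: mutually_singular_def emeasure_normalized)

context common_part
begin

lemma emeasure_eq_0_or_pos: "emeasure \<mu>\<^sub>0 UNIV = 0 \<or> 0 < measure \<mu>\<^sub>0 UNIV"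
  by (auto simp: \<mu>\<^sub>0.emeasure_eq_measure less_le)

lemma normalized_parts:
  assumes "0 < measure \<mu>\<^sub>0 UNIV"
  shows "real_distribution (normalized \<mu>\<^sub>0)" "real_distribution (normalized \<nu>\<^sub>0)"
    "mutually_singular (normalized \<mu>\<^sub>0) (normalized \<nu>\<^sub>0)"
  using assms total_mass(2) singular_parts
  by (auto intro!: real_distribution_normalized mutually_singular_normalized \<mu>\<^sub>0.finite_measure_axioms \<nu>\<^sub>0.finite_measure_axioms
    simp: \<mu>\<^sub>0.emeasure_eq_measure \<nu>\<^sub>0.emeasure_eq_measure)

abbreviation "residual_coupling \<equiv> singular_excursion_coupling (normalized \<mu>\<^sub>0) (normalized \<nu>\<^sub>0)"

lemma residual_coupling_in_Marg:
  assumes "0 < measure \<mu>\<^sub>0 UNIV"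
  shows "residual_coupling \<in> Marg (normalized \<mu>\<^sub>0) (normalized \<nu>\<^sub>0)"
proof -
  interpret P: distribution_pair "normalized \<mu>\<^sub>0" "normalized \<nu>\<^sub>0"
    using normalized_parts[OF assms] by (intro distribution_pair.intro)
  show ?thesis by (rule P.coupling_in_Marg) (rule normalized_parts[OF assms])
qed

text \<open>If \<open>\<mu>\<^sub>0\<close> is the null measure, then \<open>residual_coupling\<close> is not a coupling of probability measures, but its
  weight vanishes.\<close>

lemma weighted_residual_coupling_marginals:
  assumes A: "A \<in> sets borel"
  shows "emeasure \<mu>\<^sub>0 UNIV * emeasure residual_coupling (fst -` A) = emeasure \<mu>\<^sub>0 A"
    and "emeasure \<mu>\<^sub>0 UNIV * emeasure residual_coupling (snd -` A) = emeasure \<nu>\<^sub>0 A"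
proof -
  have "emeasure \<mu>\<^sub>0 UNIV * emeasure residual_coupling (fst -` A) = emeasure \<mu>\<^sub>0 A \<and>
    emeasure \<mu>\<^sub>0 UNIV * emeasure residual_coupling (snd -` A) = emeasure \<nu>\<^sub>0 A"
    using emeasure_eq_0_or_pos
  proof
    assume 0: "emeasure \<mu>\<^sub>0 UNIV = 0"
    have "emeasure \<mu>\<^sub>0 A \<le> emeasure \<mu>\<^sub>0 UNIV" "emeasure \<nu>\<^sub>0 A \<le> emeasure \<nu>\<^sub>0 UNIV"
      using A by (auto intro!: emeasure_mono)
    with 0 show ?thesis by (simp add: emeasure_total_eq)
  next
    assume pos: "0 < measure \<mu>\<^sub>0 UNIV"
    from residual_coupling_in_Marg[OF pos] have marg: "sets residual_coupling = sets borel \<and>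
      distr residual_coupling borel fst = normalized \<mu>\<^sub>0 \<and> distr residual_coupling borel snd = normalized \<nu>\<^sub>0"
      by (simp add: Marg_def)
    then have sets_residual_coupling: "sets residual_coupling = sets borel" by simp
    have sp: "space residual_coupling = UNIV" using sets_eq_imp_space_eq[OF sets_residual_coupling] by simp
    have m: "f \<in> residual_coupling \<rightarrow>\<^sub>M borel" if "f \<in> borel_measurable borel" for f :: "real \<times> real \<Rightarrow> real"
      using that by (simp add: measurable_cong_sets[OF sets_residual_coupling refl])
    have "emeasure residual_coupling (fst -` A) = emeasure (normalized \<mu>\<^sub>0) A" "emeasure residual_coupling (snd -` A) = emeasure (normalized \<nu>\<^sub>0) A"
      using marg A emeasure_distr[OF m[OF borel_measurable_fst_snd_borel(1)] A] emeasure_distr[OF m[OF borel_measurable_fst_snd_borel(2)] A]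
      by (simp_all add: sp)
    then show ?thesis
      using pos by (simp add: emeasure_normalized emeasure_total_eq ennreal_mult_inverse_cancel \<mu>\<^sub>0.emeasure_eq_measure)
  qed
  then show "emeasure \<mu>\<^sub>0 UNIV * emeasure residual_coupling (fst -` A) = emeasure \<mu>\<^sub>0 A"
    "emeasure \<mu>\<^sub>0 UNIV * emeasure residual_coupling (snd -` A) = emeasure \<nu>\<^sub>0 A" by auto
qed

lemma sets_excursion_coupling: "sets (excursion_coupling \<eta> \<mu>\<^sub>0 \<nu>\<^sub>0) = sets borel"
  unfolding excursion_coupling_def
  using sets.sigma_sets_eq[of "borel :: (real \<times> real) measure"] by (subst sets_measure_of) auto

lemma measurable_diagonal: "(\<lambda>x::real. (x, x)) \<in> borel_measurable borel"
  by (intro borel_measurable_Pair) auto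

lemma emeasure_excursion_coupling:
  assumes C: "C \<in> sets borel"
  shows "emeasure (excursion_coupling \<eta> \<mu>\<^sub>0 \<nu>\<^sub>0) C =
    emeasure \<eta> {x. (x, x) \<in> C} + emeasure \<mu>\<^sub>0 UNIV * emeasure residual_coupling C"
proof -
  let ?D = "distr \<eta> borel (\<lambda>x. (x, x))"
  have "(\<lambda>x. (x, x)) \<in> \<eta> \<rightarrow>\<^sub>M borel" using measurable_diagonal measurable_cong_sets[OF sets_parts(1) refl] by blast
  then have "emeasure ?D C = emeasure \<eta> {x. (x, x) \<in> C}"
    using C by (simp add: emeasure_distr vimage_def)
  moreover have "emeasure (excursion_coupling \<eta> \<mu>\<^sub>0 \<nu>\<^sub>0) C = emeasure ?D C + emeasure \<mu>\<^sub>0 UNIV * emeasure residual_coupling C"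
    using emeasure_eq_0_or_pos
  proof
    assume 0: "emeasure \<mu>\<^sub>0 UNIV = 0"
    have "emeasure (measure_of UNIV (sets borel) (\<lambda>C. emeasure ?D C + 0 * emeasure ?D C)) C = emeasure ?D C + 0 * emeasure ?D C"
      by (rule emeasure_add_scaled) (use C in auto)
    then show ?thesis unfolding excursion_coupling_def 0 by simp
  next
    assume pos: "0 < measure \<mu>\<^sub>0 UNIV"
    show ?thesis
      unfolding excursion_coupling_def
      using residual_coupling_in_Marg[OF pos] C by (intro emeasure_add_scaled) (auto simp: Marg_def)
  qed
  ultimately show ?thesis by simp
qed

lemma marginals_excursion_coupling:
  "distr (excursion_coupling \<eta> \<mu>\<^sub>0 \<nu>\<^sub>0) borel fst = \<mu>"
  "distr (excursion_coupling \<eta> \<mu>\<^sub>0 \<nu>\<^sub>0) borel snd = \<nu>"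
proof -
  let ?E = "excursion_coupling \<eta> \<mu>\<^sub>0 \<nu>\<^sub>0"
  have sp: "space ?E = UNIV" using sets_eq_imp_space_eq[OF sets_excursion_coupling] by simp
  have m: "f \<in> ?E \<rightarrow>\<^sub>M borel" if "f \<in> borel_measurable borel" for f :: "real \<times> real \<Rightarrow> real"
    using that by (simp add: measurable_cong_sets[OF sets_excursion_coupling refl])
  have b: "f -` A \<in> sets borel" if "f \<in> borel_measurable borel" "A \<in> sets borel" for f :: "real \<times> real \<Rightarrow> real" and A
    using measurable_sets[OF that] by simp
  note fs = borel_measurable_fst_snd_borel
  show "distr ?E borel fst = \<mu>"
  proof (rule measure_eqI)
    fix A assume "A \<in> sets (distr ?E borel fst)"
    then have A: "A \<in> sets borel" by simp
    then show "emeasure (distr ?E borel fst) A = emeasure \<mu> A"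
      by (simp add: emeasure_distr m fs sp emeasure_excursion_coupling b weighted_residual_coupling_marginals emeasure_parts)
  qed simp
  show "distr ?E borel snd = \<nu>"
  proof (rule measure_eqI)
    fix A assume "A \<in> sets (distr ?E borel snd)"
    then have A: "A \<in> sets borel" by simp
    then show "emeasure (distr ?E borel snd) A = emeasure \<nu> A"
      by (simp add: emeasure_distr m fs sp emeasure_excursion_coupling b weighted_residual_coupling_marginals emeasure_parts)
  qed simp
qed

lemma excursion_coupling_in_Marg: "excursion_coupling \<eta> \<mu>\<^sub>0 \<nu>\<^sub>0 \<in> Marg \<mu> \<nu>"
proof -
  let ?E = "excursion_coupling \<eta> \<mu>\<^sub>0 \<nu>\<^sub>0"
  have "prob_space (distr ?E borel fst)" unfolding marginals_excursion_coupling by (rule M.prob_space_axioms)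
  moreover have "fst \<in> ?E \<rightarrow>\<^sub>M borel"
    by (simp add: measurable_cong_sets[OF sets_excursion_coupling refl] borel_measurable_fst_snd_borel)
  ultimately have "prob_space ?E" by (rule prob_space_distrD[rotated])
  then show ?thesis by (simp add: Marg_def sets_excursion_coupling marginals_excursion_coupling)
qed

text \<open>On \<open>E\<close> the pair lies almost surely on the diagonal, so its law there is determined by the law of \<open>X\<close>. The
  weights \<open>\<eta> UNIV\<close> and \<open>\<mu>\<^sub>0 UNIV\<close> undo the conditioning on \<open>E\<close> and on its complement; a part of
  weight \<open>0\<close> contributes nothing.\<close>

lemma mixture_law:
  fixes M :: "'a measure"
  assumes "prob_space M" and X[measurable]: "X \<in> borel_measurable M" and Y[measurable]: "Y \<in> borel_measurable M"
    and E[measurable]: "E \<in> sets M" and ME: "measure M E = measure \<eta> UNIV"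
    and diag: "AE \<omega> in M. \<omega> \<in> E \<longrightarrow> X \<omega> = Y \<omega>"
    and on_E: "0 < measure \<eta> UNIV \<Longrightarrow> distr (uniform_measure M E) borel X = normalized \<eta>"
    and off_E: "0 < measure \<mu>\<^sub>0 UNIV \<Longrightarrow> distr (uniform_measure M (space M - E)) borel (\<lambda>\<omega>. (X \<omega>, Y \<omega>)) = residual_coupling"
  shows "distr M borel (\<lambda>\<omega>. (X \<omega>, Y \<omega>)) = excursion_coupling \<eta> \<mu>\<^sub>0 \<nu>\<^sub>0"
proof (rule measure_eqI)
  interpret prob_space M by fact
  fix C assume "C \<in> sets (distr M borel (\<lambda>\<omega>. (X \<omega>, Y \<omega>)))"
  then have C[measurable]: "C \<in> sets borel" by simp
  let ?Z = "{\<omega> \<in> space M. (X \<omega>, Y \<omega>) \<in> C}" and ?D = "{x. (x, x) \<in> C}"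
  have D[measurable]: "?D \<in> sets borel"
    using measurable_sets[OF measurable_diagonal C] by (simp add: vimage_def)
  have cond: "emeasure M (S \<inter> B) = emeasure M S * emeasure (uniform_measure M S) B"
    if "S \<in> sets M" "B \<in> sets M" for S B
  proof (cases "emeasure M S = 0")
    case True
    have "emeasure M (S \<inter> B) \<le> emeasure M S" using that by (intro emeasure_mono) auto
    with True show ?thesis by simp
  next
    case False
    with that emeasure_finite[of S] show ?thesis
      by (simp add: ennreal_times_divide mult.commute[of "emeasure M S"] mult_divide_eq_ennreal)
  qed
  have eta: "emeasure M (E \<inter> ?Z) = emeasure \<eta> ?D"
  proof -
    have "emeasure M (E \<inter> ?Z) = emeasure M (E \<inter> (X -` ?D \<inter> space M))"
      using diag by (intro emeasure_eq_AE) (auto elim!: eventually_mono)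
    also have "\<dots> = emeasure M E * emeasure (uniform_measure M E) (X -` ?D \<inter> space M)"
      by (rule cond) measurable
    also have "\<dots> = emeasure \<eta> UNIV * emeasure (normalized \<eta>) ?D"
    proof (cases "0 < measure \<eta> UNIV")
      case True
      have "emeasure (normalized \<eta>) ?D = emeasure (uniform_measure M E) (X -` ?D \<inter> space M)"
        unfolding on_E[OF True, symmetric] by (subst emeasure_distr) auto
      then show ?thesis by (simp add: emeasure_eq_measure \<eta>.emeasure_eq_measure ME)
    next
      case False
      then have "measure \<eta> UNIV = 0" using measure_nonneg[of \<eta> UNIV] by simp
      then show ?thesis by (simp add: emeasure_eq_measure \<eta>.emeasure_eq_measure ME)
    qed
    also have "\<dots> = emeasure \<eta> ?D"
    proof (cases "emeasure \<eta> UNIV = 0")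
      case True
      have "emeasure \<eta> ?D \<le> emeasure \<eta> UNIV" by (intro emeasure_mono) auto
      with True show ?thesis by simp
    next
      case False
      then show ?thesis by (simp add: emeasure_normalized ennreal_mult_inverse_cancel)
    qed
    finally show ?thesis .
  qed
  have mass: "emeasure M (space M - E) = emeasure \<mu>\<^sub>0 UNIV"
    using prob_compl[OF E] total_mass(1) ME by (simp add: emeasure_eq_measure \<mu>\<^sub>0.emeasure_eq_measure)
  have rest: "emeasure M ((space M - E) \<inter> ?Z) = emeasure \<mu>\<^sub>0 UNIV * emeasure residual_coupling C"
  proof -
    have "emeasure M ((space M - E) \<inter> ?Z) = emeasure M (space M - E) * emeasure (uniform_measure M (space M - E)) ?Z"
      by (rule cond) measurable
    also have "\<dots> = emeasure \<mu>\<^sub>0 UNIV * emeasure residual_coupling C"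
      using emeasure_eq_0_or_pos
    proof
      assume pos: "0 < measure \<mu>\<^sub>0 UNIV"
      have "emeasure residual_coupling C = emeasure (uniform_measure M (space M - E)) ?Z"
      proof -
        have "(\<lambda>\<omega>. (X \<omega>, Y \<omega>)) \<in> uniform_measure M (space M - E) \<rightarrow>\<^sub>M borel" by measurable
        from emeasure_distr[OF this C] show ?thesis
          unfolding off_E[OF pos] space_uniform_measure by (simp only: vimage_def Int_def mem_Collect_eq conj_commute)
      qed
      then show ?thesis by (simp only: mass)
    qed (simp add: mass)
    finally show ?thesis .
  qed
  have "emeasure (distr M borel (\<lambda>\<omega>. (X \<omega>, Y \<omega>))) C = emeasure M ?Z"
    by (subst emeasure_distr) (auto intro!: arg_cong[where f="emeasure M"])
  also have "?Z = (E \<inter> ?Z) \<union> ((space M - E) \<inter> ?Z)" using sets.sets_into_space[OF E] by auto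
  also have "emeasure M \<dots> = emeasure M (E \<inter> ?Z) + emeasure M ((space M - E) \<inter> ?Z)"
    by (rule plus_emeasure[symmetric]) auto
  also have "\<dots> = emeasure (excursion_coupling \<eta> \<mu>\<^sub>0 \<nu>\<^sub>0) C"
    unfolding eta rest emeasure_excursion_coupling[OF C] ..
  finally show "emeasure (distr M borel (\<lambda>\<omega>. (X \<omega>, Y \<omega>))) C = emeasure (excursion_coupling \<eta> \<mu>\<^sub>0 \<nu>\<^sub>0) C" .
qed (simp add: sets_excursion_coupling)

end

theorem theorem1p1:
  fixes \<mu> \<nu> :: "real measure"
  assumes "real_distribution \<mu>" and "real_distribution \<nu>"
  shows
    "(mutually_singular \<mu> \<nu> \<longrightarrow>
       (let F = diff_cdf \<mu> \<nu>; L = level_law \<mu> \<nu> in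
        crossing_number F \<in> borel_measurable borel \<and>
        prob_space L \<and>
        (AE h in L. \<exists>N xs. 0 < N \<and> h \<noteq> 0 \<and>
           crossing_number F h = of_nat N \<and> even N \<and>
           (UNIV \<times> {h}) \<inter> Graph_star F =
             (UNIV \<times> {h}) \<inter> (Graph_star_minus F \<union> Graph_star_plus F) \<and>
           length xs = N \<and> sorted_wrt (<) xs \<and>
           (UNIV \<times> {h}) \<inter> Graph_star F = set xs \<times> {h}) \<and>
        excursion_kernel F \<in> borel \<rightarrow>\<^sub>M prob_algebra borel \<and>
        singular_excursion_coupling \<mu> \<nu> \<in> Marg \<mu> \<nu> \<and>
        (\<forall>(M :: 'a measure) H X Y.
           prob_space M \<longrightarrow>
           H \<in> borel_measurable M \<longrightarrow> X \<in> borel_measurable M \<longrightarrow> Y \<in> borel_measurable M \<longrightarrow>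
           distr M borel H = L \<longrightarrow>
           conditional_law M H (\<lambda>\<omega>. (X \<omega>, Y \<omega>)) (excursion_kernel F) \<longrightarrow>
           distr M borel (\<lambda>\<omega>. (X \<omega>, Y \<omega>)) = singular_excursion_coupling \<mu> \<nu> \<and>
           distr M borel X = \<mu> \<and> distr M borel Y = \<nu>))) \<and>
     (\<exists>!(\<eta>, \<mu>\<^sub>0, \<nu>\<^sub>0). common_part_decomposition \<mu> \<nu> \<eta> \<mu>\<^sub>0 \<nu>\<^sub>0) \<and>
     (\<forall>\<eta> \<mu>\<^sub>0 \<nu>\<^sub>0. common_part_decomposition \<mu> \<nu> \<eta> \<mu>\<^sub>0 \<nu>\<^sub>0 \<longrightarrow>
        1 - measure \<eta> UNIV = measure \<mu>\<^sub>0 UNIV \<and>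
        (0 < measure \<mu>\<^sub>0 UNIV \<longrightarrow>
           real_distribution (normalized \<mu>\<^sub>0) \<and> real_distribution (normalized \<nu>\<^sub>0) \<and>
           mutually_singular (normalized \<mu>\<^sub>0) (normalized \<nu>\<^sub>0)) \<and>
        excursion_coupling \<eta> \<mu>\<^sub>0 \<nu>\<^sub>0 \<in> Marg \<mu> \<nu> \<and>
        (\<forall>(M :: 'a measure) X Y E.
           prob_space M \<longrightarrow>
           X \<in> borel_measurable M \<longrightarrow> Y \<in> borel_measurable M \<longrightarrow> E \<in> sets M \<longrightarrow>
           measure M E = measure \<eta> UNIV \<longrightarrow>
           (AE \<omega> in M. \<omega> \<in> E \<longrightarrow> X \<omega> = Y \<omega>) \<longrightarrow>
           (0 < measure \<eta> UNIV \<longrightarrow> distr (uniform_measure M E) borel X = normalized \<eta>) \<longrightarrow>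
           (0 < measure \<mu>\<^sub>0 UNIV \<longrightarrow>
              distr (uniform_measure M (space M - E)) borel (\<lambda>\<omega>. (X \<omega>, Y \<omega>)) =
                singular_excursion_coupling (normalized \<mu>\<^sub>0) (normalized \<nu>\<^sub>0)) \<longrightarrow>
           distr M borel (\<lambda>\<omega>. (X \<omega>, Y \<omega>)) = excursion_coupling \<eta> \<mu>\<^sub>0 \<nu>\<^sub>0 \<and>
           distr M borel X = \<mu> \<and> distr M borel Y = \<nu>))"
proof (intro conjI)
  interpret distribution_pair \<mu> \<nu> using assms by (rule distribution_pair.intro)
  show "mutually_singular \<mu> \<nu> \<longrightarrow>
       (let F = diff_cdf \<mu> \<nu>; L = level_law \<mu> \<nu> in
        crossing_number F \<in> borel_measurable borel \<and>
        prob_space L \<and>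
        (AE h in L. \<exists>N xs. 0 < N \<and> h \<noteq> 0 \<and>
           crossing_number F h = of_nat N \<and> even N \<and>
           (UNIV \<times> {h}) \<inter> Graph_star F =
             (UNIV \<times> {h}) \<inter> (Graph_star_minus F \<union> Graph_star_plus F) \<and>
           length xs = N \<and> sorted_wrt (<) xs \<and>
           (UNIV \<times> {h}) \<inter> Graph_star F = set xs \<times> {h}) \<and>
        excursion_kernel F \<in> borel \<rightarrow>\<^sub>M prob_algebra borel \<and>
        singular_excursion_coupling \<mu> \<nu> \<in> Marg \<mu> \<nu> \<and>
        (\<forall>(M :: 'a measure) H X Y.
           prob_space M \<longrightarrow>
           H \<in> borel_measurable M \<longrightarrow> X \<in> borel_measurable M \<longrightarrow> Y \<in> borel_measurable M \<longrightarrow>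
           distr M borel H = L \<longrightarrow>
           conditional_law M H (\<lambda>\<omega>. (X \<omega>, Y \<omega>)) (excursion_kernel F) \<longrightarrow>
           distr M borel (\<lambda>\<omega>. (X \<omega>, Y \<omega>)) = singular_excursion_coupling \<mu> \<nu> \<and>
           distr M borel X = \<mu> \<and> distr M borel Y = \<nu>))"
    unfolding Let_def
  proof (intro impI conjI allI)
    assume sing: "mutually_singular \<mu> \<nu>"
    show "prob_space (level_law \<mu> \<nu>)" by (rule prob_space_level_law[OF sing])
    show "singular_excursion_coupling \<mu> \<nu> \<in> Marg \<mu> \<nu>" by (rule coupling_in_Marg[OF sing])
    fix M :: "'a measure" and H X Y
    assume M: "prob_space M" "H \<in> borel_measurable M" "X \<in> borel_measurable M" "Y \<in> borel_measurable M"
      "distr M borel H = level_law \<mu> \<nu>"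
      "conditional_law M H (\<lambda>\<omega>. (X \<omega>, Y \<omega>)) (excursion_kernel (diff_cdf \<mu> \<nu>))"
    show joint: "distr M borel (\<lambda>\<omega>. (X \<omega>, Y \<omega>)) = singular_excursion_coupling \<mu> \<nu>"
      by (rule conditional_law_imp_distr[OF M])
    show "distr M borel X = \<mu>" "distr M borel Y = \<nu>"
      using marginals_of_joint_law[OF M(3,4) joint] marginals_coupling[OF sing] by simp_all
  qed (rule borel_measurable_crossing_number AE_level_law_structure measurable_excursion_kernel)+
next
  show "\<exists>!(\<eta>, \<mu>\<^sub>0, \<nu>\<^sub>0). common_part_decomposition \<mu> \<nu> \<eta> \<mu>\<^sub>0 \<nu>\<^sub>0"
  proof -
    obtain \<eta> \<mu>\<^sub>0 \<nu>\<^sub>0 where d: "common_part_decomposition \<mu> \<nu> \<eta> \<mu>\<^sub>0 \<nu>\<^sub>0"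
      using common_part_decomposition_exists[OF assms] by blast
    show ?thesis
    proof (rule ex1I[of _ "(\<eta>, \<mu>\<^sub>0, \<nu>\<^sub>0)"])
      fix t assume "case t of (\<eta>, \<mu>\<^sub>0, \<nu>\<^sub>0) \<Rightarrow> common_part_decomposition \<mu> \<nu> \<eta> \<mu>\<^sub>0 \<nu>\<^sub>0"
      then show "t = (\<eta>, \<mu>\<^sub>0, \<nu>\<^sub>0)"
        using common_part_decomposition_unique[OF assms d] by (cases t) simp
    qed (simp add: d)
  qed
next
  show "\<forall>\<eta> \<mu>\<^sub>0 \<nu>\<^sub>0. common_part_decomposition \<mu> \<nu> \<eta> \<mu>\<^sub>0 \<nu>\<^sub>0 \<longrightarrow>
        1 - measure \<eta> UNIV = measure \<mu>\<^sub>0 UNIV \<and>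
        (0 < measure \<mu>\<^sub>0 UNIV \<longrightarrow>
           real_distribution (normalized \<mu>\<^sub>0) \<and> real_distribution (normalized \<nu>\<^sub>0) \<and>
           mutually_singular (normalized \<mu>\<^sub>0) (normalized \<nu>\<^sub>0)) \<and>
        excursion_coupling \<eta> \<mu>\<^sub>0 \<nu>\<^sub>0 \<in> Marg \<mu> \<nu> \<and>
        (\<forall>(M :: 'a measure) X Y E.
           prob_space M \<longrightarrow>
           X \<in> borel_measurable M \<longrightarrow> Y \<in> borel_measurable M \<longrightarrow> E \<in> sets M \<longrightarrow>
           measure M E = measure \<eta> UNIV \<longrightarrow>
           (AE \<omega> in M. \<omega> \<in> E \<longrightarrow> X \<omega> = Y \<omega>) \<longrightarrow>
           (0 < measure \<eta> UNIV \<longrightarrow> distr (uniform_measure M E) borel X = normalized \<eta>) \<longrightarrow>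
           (0 < measure \<mu>\<^sub>0 UNIV \<longrightarrow>
              distr (uniform_measure M (space M - E)) borel (\<lambda>\<omega>. (X \<omega>, Y \<omega>)) =
                singular_excursion_coupling (normalized \<mu>\<^sub>0) (normalized \<nu>\<^sub>0)) \<longrightarrow>
           distr M borel (\<lambda>\<omega>. (X \<omega>, Y \<omega>)) = excursion_coupling \<eta> \<mu>\<^sub>0 \<nu>\<^sub>0 \<and>
           distr M borel X = \<mu> \<and> distr M borel Y = \<nu>)"
  proof (intro allI impI)
    fix \<eta> \<mu>\<^sub>0 \<nu>\<^sub>0 assume d: "common_part_decomposition \<mu> \<nu> \<eta> \<mu>\<^sub>0 \<nu>\<^sub>0"
    interpret common_part \<mu> \<nu> \<eta> \<mu>\<^sub>0 \<nu>\<^sub>0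
      using assms d by (intro common_part.intro distribution_pair.intro common_part_axioms.intro)
    show "1 - measure \<eta> UNIV = measure \<mu>\<^sub>0 UNIV \<and>
        (0 < measure \<mu>\<^sub>0 UNIV \<longrightarrow>
           real_distribution (normalized \<mu>\<^sub>0) \<and> real_distribution (normalized \<nu>\<^sub>0) \<and>
           mutually_singular (normalized \<mu>\<^sub>0) (normalized \<nu>\<^sub>0)) \<and>
        excursion_coupling \<eta> \<mu>\<^sub>0 \<nu>\<^sub>0 \<in> Marg \<mu> \<nu> \<and>
        (\<forall>(M :: 'a measure) X Y E.
           prob_space M \<longrightarrow>
           X \<in> borel_measurable M \<longrightarrow> Y \<in> borel_measurable M \<longrightarrow> E \<in> sets M \<longrightarrow>
           measure M E = measure \<eta> UNIV \<longrightarrow>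
           (AE \<omega> in M. \<omega> \<in> E \<longrightarrow> X \<omega> = Y \<omega>) \<longrightarrow>
           (0 < measure \<eta> UNIV \<longrightarrow> distr (uniform_measure M E) borel X = normalized \<eta>) \<longrightarrow>
           (0 < measure \<mu>\<^sub>0 UNIV \<longrightarrow>
              distr (uniform_measure M (space M - E)) borel (\<lambda>\<omega>. (X \<omega>, Y \<omega>)) = residual_coupling) \<longrightarrow>
           distr M borel (\<lambda>\<omega>. (X \<omega>, Y \<omega>)) = excursion_coupling \<eta> \<mu>\<^sub>0 \<nu>\<^sub>0 \<and>
           distr M borel X = \<mu> \<and> distr M borel Y = \<nu>)"
    proof (intro conjI allI impI)
      fix M :: "'a measure" and X Y E
      assume M: "prob_space M" "X \<in> borel_measurable M" "Y \<in> borel_measurable M" "E \<in> sets M"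
        "measure M E = measure \<eta> UNIV" "AE \<omega> in M. \<omega> \<in> E \<longrightarrow> X \<omega> = Y \<omega>"
        "0 < measure \<eta> UNIV \<longrightarrow> distr (uniform_measure M E) borel X = normalized \<eta>"
        "0 < measure \<mu>\<^sub>0 UNIV \<longrightarrow>
           distr (uniform_measure M (space M - E)) borel (\<lambda>\<omega>. (X \<omega>, Y \<omega>)) = residual_coupling"
      show joint: "distr M borel (\<lambda>\<omega>. (X \<omega>, Y \<omega>)) = excursion_coupling \<eta> \<mu>\<^sub>0 \<nu>\<^sub>0"
        by (rule mixture_law[OF M(1-6) M(7,8)[rule_format]])
      show "distr M borel X = \<mu>" "distr M borel Y = \<nu>"
        using marginals_of_joint_law[OF M(2,3) joint] marginals_excursion_coupling by simp_all
    qed (fact total_mass normalized_parts excursion_coupling_in_Marg)+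
  qed
qed

end
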